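(* Given $\bar T>0$, call *minimum dwell-time conditions* the following: there exist a bounded continuously differentiable matrix-valued function $S:[0,\bar T]\times\mathcal{P}\to\mathbb{S}^n_{\succ0}$ and a scalar $\varepsilon>0$ such that $$\partial_\rho S(\bar T,\theta)\mu+\mathrm{Sym}[S(\bar T,\theta)A(\theta)]+\varepsilon I_n\preceq0,$$ $$\partial_\tau S(\tau,\theta)+\partial_\rho S(\tau,\theta)\mu+\mathrm{Sym}[S(\tau,\theta)A(\theta)]+\varepsilon I_n\preceq0,$$ $$S(0,\theta)-S(\bar T,\eta)\preceq0$$ hold for all $\theta,\eta\in\mathcal{P}$, all $\mu\in\mathcal{D}^v$ and all $\tau\in[0,\bar T]$. When $\bar T\to\infty$, the minimum dwell-time conditions are equivalent to saying that there exists a differentiable matrix-valued function $P:\mathcal{P}\to\mathbb{S}^n_{\succ0}$ such that $$\partial_\rho P(\theta)\mu+A(\theta)^TP(\theta)+P(\theta)A(\theta)\prec0$$ for all $\theta\in\mathcal{P}$ and all $\mu\in\mathcal{D}^v$.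
   Context: Notation: $\mathbb{S}^n$ is the set of real symmetric $n\times n$ matrices and $\mathbb{S}^n_{\succ0}$ the set of positive definite ones; $A\preceq B$ (resp. $A\prec B$) means that $B-A$ is positive semidefinite (resp. positive definite); $\mathrm{Sym}[M]:=M+M^T$; $I_n$ is the identity matrix. Setting: the linear parameter-varying (LPV) system $\dot x(t)=A(\rho(t))x(t)$, $x(0)=x_0$, with $x(t),x_0\in\mathbb{R}^n$, where $A(\cdot)\in\mathbb{R}^{n\times n}$ is bounded and continuous and $\rho:\mathbb{R}_{\ge0}\to\mathcal{P}$ is piecewise differentiable with derivative in $\mathcal{D}$; $\bar T$ is the minimum dwell-time, i.e. a lower bound on the time between two successive possible discontinuities of $\rho$. Here $\mathcal{P}=\mathcal{P}_1\times\dots\times\mathcal{P}_N\subset\mathbb{R}^N$ with $\mathcal{P}_i=[\underline\rho_i,\bar\rho_i]$, $\underline\rho_i\le\bar\rho_i$; $\mathcal{D}=\mathcal{D}_1\times\dots\times\mathcal{D}_N$ with $\mathcal{D}_i=[\underline\nu_i,\bar\nu_i]$, $\underline\nu_i\le\bar\nu_i$; and $\mathcal{D}^v=\{\underline\nu_1,\bar\nu_1\}\times\dots\times\{\underline\nu_N,\bar\nu_N\}$ is the set of vertices of $\mathcal{D}$. For $S=S(\tau,\rho)$, $\partial_\tau S$ and $\partial_\rho S$ are the partial derivatives with respect to the first and second argument, $\partial_\rho S(\tau,\theta)\mu=\sum_{i=1}^N\mu_i\,\partial_{\rho_i}S(\tau,\theta)$, and likewise $\partial_\rho P(\theta)\mu=\sum_{i=1}^N\mu_i\,\partial_{\rho_i}P(\theta)$.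 *)

theory Defs
  imports "HOL-Analysis.Analysis"
begin

definition pos_semidef :: "real ^ 'n ^ 'n \<Rightarrow> bool" where
  "pos_semidef M \<longleftrightarrow> transpose M = M \<and> (\<forall>x. 0 \<le> x \<bullet> (M *v x))"

definition pos_def :: "real ^ 'n ^ 'n \<Rightarrow> bool" where
  "pos_def M \<longleftrightarrow> transpose M = M \<and> (\<forall>x. x \<noteq> 0 \<longrightarrow> 0 < x \<bullet> (M *v x))"

definition loewner_le :: "real ^ 'n ^ 'n \<Rightarrow> real ^ 'n ^ 'n \<Rightarrow> bool"  (infix "\<preceq>\<^sub>L" 50) where
  "A \<preceq>\<^sub>L B \<longleftrightarrow> pos_semidef (B - A)"

definition loewner_less :: "real ^ 'n ^ 'n \<Rightarrow> real ^ 'n ^ 'n \<Rightarrow> bool"  (infix "\<prec>\<^sub>L" 50) where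
  "A \<prec>\<^sub>L B \<longleftrightarrow> pos_def (B - A)"

definition Sym :: "real ^ 'n ^ 'n \<Rightarrow> real ^ 'n ^ 'n" where
  "Sym M = M + transpose M"

definition box_vertices :: "real ^ 'N \<Rightarrow> real ^ 'N \<Rightarrow> (real ^ 'N) set" where
  "box_vertices l u = {\<mu>. \<forall>i. \<mu> $ i \<in> {l $ i, u $ i}}"

text \<open>
  Partial derivative in the \<open>i\<close>-th coordinate of a function given on the box \<open>cbox l u\<close> only
  (hence one-sided on the faces). If \<open>l $ i = u $ i\<close>, the function has no dependence on the
  \<open>i\<close>-th coordinate and no difference quotient exists; the partial derivative is then set to 0.
\<close>

definition box_partial ::
    "real ^ 'N \<Rightarrow> real ^ 'N \<Rightarrow> (real ^ 'N \<Rightarrow> 'b::real_normed_vector) \<Rightarrow> 'N \<Rightarrow> real ^ 'N \<Rightarrow> 'b" where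
  "box_partial l u F i \<theta> =
     (if l $ i < u $ i
      then vector_derivative (\<lambda>s. F (\<chi> j. if j = i then s else \<theta> $ j))
             (at (\<theta> $ i) within {l $ i .. u $ i})
      else 0)"

definition box_deriv ::
    "real ^ 'N \<Rightarrow> real ^ 'N \<Rightarrow> (real ^ 'N \<Rightarrow> 'b::real_normed_vector) \<Rightarrow> real ^ 'N \<Rightarrow> real ^ 'N \<Rightarrow> 'b" where
  "box_deriv l u F \<theta> \<mu> = (\<Sum>i\<in>UNIV. \<mu> $ i *\<^sub>R box_partial l u F i \<theta>)"

definition time_partial ::
    "real \<Rightarrow> (real \<times> (real ^ 'N) \<Rightarrow> 'b::real_normed_vector) \<Rightarrow> real \<Rightarrow> real ^ 'N \<Rightarrow> 'b" where
  "time_partial T S \<tau> \<theta> = vector_derivative (\<lambda>s. S (s, \<theta>)) (at \<tau> within {0..T})"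

definition C1_on_time_box ::
    "real \<Rightarrow> real ^ 'N \<Rightarrow> real ^ 'N \<Rightarrow> (real \<times> (real ^ 'N) \<Rightarrow> 'b::real_normed_vector) \<Rightarrow> bool" where
  "C1_on_time_box T l u S \<longleftrightarrow>
     S differentiable_on ({0..T} \<times> cbox l u) \<and>
     continuous_on ({0..T} \<times> cbox l u) (\<lambda>(\<tau>, \<theta>). time_partial T S \<tau> \<theta>) \<and>
     (\<forall>i. continuous_on ({0..T} \<times> cbox l u) (\<lambda>(\<tau>, \<theta>). box_partial l u (\<lambda>\<theta>'. S (\<tau>, \<theta>')) i \<theta>))"

definition min_dwell_time_conditions ::
    "real ^ 'N \<Rightarrow> real ^ 'N \<Rightarrow> real ^ 'N \<Rightarrow> real ^ 'N \<Rightarrow> (real ^ 'N \<Rightarrow> real ^ 'n ^ 'n) \<Rightarrow> real \<Rightarrow> bool"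
  where
  "min_dwell_time_conditions \<rho>l \<rho>u \<nu>l \<nu>u A T \<longleftrightarrow>
     (\<exists>(S :: real \<times> (real ^ 'N) \<Rightarrow> real ^ 'n ^ 'n) (\<epsilon>::real).
        bounded (S ` ({0..T} \<times> cbox \<rho>l \<rho>u)) \<and>
        C1_on_time_box T \<rho>l \<rho>u S \<and>
        (\<forall>\<tau>\<in>{0..T}. \<forall>\<theta>\<in>cbox \<rho>l \<rho>u. pos_def (S (\<tau>, \<theta>))) \<and>
        \<epsilon> > 0 \<and>
        (\<forall>\<theta>\<in>cbox \<rho>l \<rho>u. \<forall>\<eta>\<in>cbox \<rho>l \<rho>u. \<forall>\<mu>\<in>box_vertices \<nu>l \<nu>u. \<forall>\<tau>\<in>{0..T}.
           box_deriv \<rho>l \<rho>u (\<lambda>\<theta>'. S (T, \<theta>')) \<theta> \<mu> + Sym (S (T, \<theta>) ** A \<theta>) + \<epsilon> *\<^sub>R mat 1 \<preceq>\<^sub>L 0 \<and>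
           time_partial T S \<tau> \<theta> + box_deriv \<rho>l \<rho>u (\<lambda>\<theta>'. S (\<tau>, \<theta>')) \<theta> \<mu>
             + Sym (S (\<tau>, \<theta>) ** A \<theta>) + \<epsilon> *\<^sub>R mat 1 \<preceq>\<^sub>L 0 \<and>
           S (0, \<theta>) - S (T, \<eta>) \<preceq>\<^sub>L 0))"

end

theory Submission
  imports Defs
begin

text \<open>
  If the dwell-time conditions hold for one \<open>T \<ge> 0\<close> with certificate \<open>S\<close>, then
  \<open>P = S (T, \<cdot>)\<close> works: the margin \<open>\<epsilon> I\<close> makes the inequality at \<open>\<tau> = T\<close> strict.

  Conversely, suppose that \<open>Q\<close> is continuously differentiable, positive definite, and satisfies the
  strict inequality.
  By compactness there are \<open>\<delta> > 0\<close> and \<open>0 < a \<le> B\<close> such that the Lyapunov expression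
  is at most \<open>- \<delta> I\<close> and \<open>a I \<le> Q \<le> B I\<close>. Then \<open>S (\<tau>, \<theta>) = exp (\<kappa> \<tau>) Q \<theta>\<close> with
  \<open>\<kappa> = \<delta> / (2 B)\<close> is a certificate for every large \<open>T\<close>: the growth in \<open>\<tau>\<close> uses up half of the
  decay \<open>\<delta>\<close>, and once \<open>exp (\<kappa> T) a \<ge> B\<close> it pays for every jump of the parameter
  (lemma \<open>min_dwell_time_conditions_of_margins\<close>).

  The difficulty is that \<open>P\<close> is only differentiable. Its partial derivatives may be discontinuous, so the
  strict inequality may have no uniform margin, and \<open>P\<close> itself need not be an admissible \<open>S (\<tau>, \<cdot>)\<close>.
  Mollifying \<open>P\<close> gives continuously differentiable \<open>P\<^sub>m\<close> with \<open>P\<^sub>m \<rightarrow> P\<close> and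
  \<open>DP\<^sub>m \<rightarrow> DP\<close> pointwise, but not uniformly, and no single \<open>P\<^sub>m\<close> need satisfy the inequality
  everywhere. Two facts help. The inequality bounds \<open>DP \<mu>\<close> from above by
  \<open>- (A\<^sup>T P + P A)\<close>, hence by a constant, and averaging preserves this one-sided bound.
  Moreover the inequality is linear in \<open>P\<close>, so convex combinations of the \<open>P\<^sub>m\<close> may be used.
  So consider the continuous functions
  \<open>G\<^sub>m (\<theta>, \<mu>, x) = x\<^sup>T (DP\<^sub>m \<mu> + A\<^sup>T P\<^sub>m + P\<^sub>m A) x\<close>
  on the compact set of all \<open>\<theta>\<close>, all vertices \<open>\<mu>\<close> and all unit vectors \<open>x\<close>: they are
  bounded above by one constant and converge pointwise to a negative function. If no convex combination
  were negative everywhere, the Hahn--Banach theorem would give a probability measure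
  for which every \<open>G\<^sub>m\<close> has a nonnegative integral, against Fatou's lemma. Lemma
  \<open>compact_convex_family_negative\<close> proves this Mazur-type statement without measures, by the
  argument behind Simons' inequality, and lemma \<open>exists_C1_strict_lyapunov\<close> applies it.
\<close>

section \<open>Negative elements of convex families of continuous functions\<close>

text \<open>
  A one-sided version of Simons' inequality. Think of \<open>W n\<close> as the convex hull of the tail
  \<open>f\<^sub>n, f\<^sub>n\<^sub>+\<^sub>1, \<dots>\<close> of a sequence. The proof builds \<open>v = \<Sum>n. g\<^sub>n / 2\<^sup>n\<^sup>+\<^sup>1\<close> with
  \<open>g\<^sub>n \<in> W n\<close> chosen almost optimally: \<open>g\<^sub>n\<close> nearly minimises the supremum of
  \<open>v\<^sub>n + g / 2\<^sup>n\<close> over \<open>g \<in> W n\<close>. At a point \<open>b\<close> where \<open>v\<close> is maximal, optimality keeps the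
  scaled remainders \<open>2\<^sup>n (v b - v\<^sub>n b)\<close> above a positive constant, which contradicts
  \<open>g\<^sub>n b \<le> 0\<close> for large \<open>n\<close>. The functions have no common lower bound, so the series need not converge;
  the decreasing functions \<open>u\<^sub>n = v\<^sub>n + C / 2\<^sup>n\<close> and a nested-compactness argument replace
  the maximum point of \<open>v\<close>.
\<close>

lemma compact_convex_family_less:
  fixes W :: "nat \<Rightarrow> ('k::heine_borel \<Rightarrow> real) set"
  assumes K: "compact K" "K \<noteq> {}"
    and ne: "\<And>n. W n \<noteq> {}"
    and dec: "\<And>n. W (Suc n) \<subseteq> W n"
    and cvx: "\<And>n f g t. f \<in> W n \<Longrightarrow> g \<in> W n \<Longrightarrow> 0 \<le> t \<Longrightarrow> t \<le> 1 \<Longrightarrow>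
               (\<lambda>x. t * f x + (1 - t) * g x) \<in> W n"
    and cont: "\<And>f. f \<in> W 0 \<Longrightarrow> continuous_on K f"
    and ub: "\<And>f x. f \<in> W 0 \<Longrightarrow> x \<in> K \<Longrightarrow> f x \<le> C"
    and ev: "\<And>x. x \<in> K \<Longrightarrow> \<exists>n. \<forall>f\<in>W n. f x \<le> 0"
    and \<eta>: "\<eta> > 0"
  shows "\<exists>f\<in>W 0. \<forall>x\<in>K. f x < \<eta>"
proof (rule ccontr)
  assume "\<not> ?thesis"
  then have big: "\<exists>x\<in>K. \<eta> \<le> f x" if "f \<in> W 0" for f
    using that by (meson not_le)
  define p where "p f = Sup (f ` K)" for f :: "'k \<Rightarrow> real"
  have p_upper: "f x \<le> p f" if "continuous_on K f" "x \<in> K" for f x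
    unfolding p_def
    by (rule cSup_upper) (use that K in \<open>auto intro!: bounded_imp_bdd_above compact_imp_bounded compact_continuous_image\<close>)
  have p_attained: "\<exists>x\<in>K. p f = f x" if f: "continuous_on K f" for f
  proof -
    obtain x where x: "x \<in> K" "\<forall>y\<in>K. f y \<le> f x"
      using continuous_attains_sup[OF K f] by blast
    have "p f = f x"
      unfolding p_def by (rule cSup_eq_maximum) (use x in auto)
    with x show ?thesis by blast
  qed
  have W0: "W n \<subseteq> W 0" for n
    by (induction n) (use dec in auto)
  have mid: "(\<lambda>x. (f x + g x) / 2) \<in> W n" if "f \<in> W n" "g \<in> W n" for f g n
    using cvx[OF that, of "1/2"] by (simp add: field_simps)
  \<comment> \<open>Tolerances small enough that \<open>\<Sum>n. 2\<^sup>n e n = \<eta> / 2\<close>, as the recursion below doubles errors.\<close>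
  define e where "e n = \<eta> / 4 * (1/4)^n" for n :: nat
  have e_pos: "e n > 0" for n using \<eta> by (simp add: e_def)
  \<comment> \<open>\<open>I\<close> keeps the partial sums completable inside \<open>W 0\<close>, so that the infimum defining the next choice
    is at least \<open>\<eta>\<close>; \<open>J\<close> is one almost optimal step.\<close>
  define I where "I n v \<longleftrightarrow> (\<forall>h\<in>W n. (\<lambda>x. v x + (1/2)^n * h x) \<in> W 0)" for n and v :: "'k \<Rightarrow> real"
  define J where "J n v v' \<longleftrightarrow> (\<exists>g\<in>W n. v' = (\<lambda>x. v x + (1/2)^Suc n * g x) \<and>
      (\<forall>h\<in>W n. p (\<lambda>x. v x + (1/2)^n * g x) \<le> p (\<lambda>x. v x + (1/2)^n * h x) + e n))"
    for n and v v' :: "'k \<Rightarrow> real"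
  have "\<exists>v. \<forall>n. ((n = 0 \<longrightarrow> v n = (\<lambda>x. 0)) \<and> I n (v n)) \<and> J n (v n) (v (Suc n))"
  proof (rule dependent_nat_choice)
    show "\<exists>v. (0 = (0::nat) \<longrightarrow> v = (\<lambda>x. 0)) \<and> I 0 v"
      by (rule exI[of _ "\<lambda>x. 0"]) (simp add: I_def)
  next
    fix v :: "'k \<Rightarrow> real" and n
    assume v: "(n = 0 \<longrightarrow> v = (\<lambda>x. 0)) \<and> I n v"
    define X where "X = (\<lambda>h. p (\<lambda>x. v x + (1/2)^n * h x)) ` W n"
    have Xb: "\<eta> \<le> y" if yX: "y \<in> X" for y
    proof -
      obtain h where h: "h \<in> W n" "y = p (\<lambda>x. v x + (1/2)^n * h x)"
        using yX unfolding X_def by blast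
      have m: "(\<lambda>x. v x + (1/2)^n * h x) \<in> W 0" using v h by (auto simp: I_def)
      show ?thesis using big[OF m] p_upper[OF cont[OF m]] h by fastforce
    qed
    have bdd: "bdd_below X" using Xb by (meson bdd_below.I)
    have "X \<noteq> {}" using ne by (simp add: X_def)
    then obtain y where "y \<in> X" "y < Inf X + e n"
      using cInf_lessD[of X "Inf X + e n"] e_pos by auto
    then obtain g where g: "g \<in> W n" "p (\<lambda>x. v x + (1/2)^n * g x) < Inf X + e n"
      by (auto simp: X_def)
    have "p (\<lambda>x. v x + (1/2)^n * g x) \<le> p (\<lambda>x. v x + (1/2)^n * h x) + e n" if "h \<in> W n" for h
      using g(2) cInf_lower[OF _ bdd, of "p (\<lambda>x. v x + (1/2)^n * h x)"] that by (auto simp: X_def)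
    then have 1: "J n v (\<lambda>x. v x + (1/2)^Suc n * g x)"
      unfolding J_def using g(1) by blast
    have "(\<lambda>x. (v x + (1/2)^Suc n * g x) + (1/2)^Suc n * h x) \<in> W 0" if "h \<in> W (Suc n)" for h
    proof -
      have "h \<in> W n" using that dec by blast
      from mid[OF g(1) this] v have "(\<lambda>x. v x + (1/2)^n * ((g x + h x) / 2)) \<in> W 0"
        by (auto simp: I_def)
      then show ?thesis by (simp add: field_simps)
    qed
    then have "I (Suc n) (\<lambda>x. v x + (1/2)^Suc n * g x)" by (simp add: I_def)
    with 1 show "\<exists>y. ((Suc n = 0 \<longrightarrow> y = (\<lambda>x. 0)) \<and> I (Suc n) y) \<and> J n v y" by blast
  qed
  then obtain v where v0: "v 0 = (\<lambda>x. 0)" and vI: "\<And>n. I n (v n)" and vJ: "\<And>n. J n (v n) (v (Suc n))"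
    by blast
  have "\<forall>n. \<exists>g. g\<in>W n \<and> v (Suc n) = (\<lambda>x. v n x + (1/2)^Suc n * g x) \<and>
      (\<forall>h\<in>W n. p (\<lambda>x. v n x + (1/2)^n * g x) \<le> p (\<lambda>x. v n x + (1/2)^n * h x) + e n)"
    using vJ by (auto simp: J_def)
  from choice[OF this] obtain g where g: "\<And>n. g n \<in> W n"
    and v_Suc: "\<And>n. v (Suc n) = (\<lambda>x. v n x + (1/2)^Suc n * g n x)"
    and g_min: "\<And>n h. h \<in> W n \<Longrightarrow> p (\<lambda>x. v n x + (1/2)^n * g n x) \<le> p (\<lambda>x. v n x + (1/2)^n * h x) + e n"
    by blast
  define w where "w n = (\<lambda>x. v n x + (1/2)^n * g n x)" for n
  define u where "u n = (\<lambda>x. v n x + (1/2)^n * C)" for n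
  have w0: "w n \<in> W 0" for n using vI[of n] g[of n] by (simp add: I_def w_def)
  have cw: "continuous_on K (w n)" for n using cont w0 by blast
  have cv: "continuous_on K (v n)" for n
  proof (induction n)
    case 0 then show ?case by (simp add: v0)
  next
    case (Suc n)
    have "continuous_on K (g n)" using cont g W0 by blast
    with Suc show ?case by (auto simp: v_Suc intro!: continuous_intros)
  qed
  have cu: "continuous_on K (u n)" for n unfolding u_def by (intro continuous_intros cv)
  have gC: "g n x \<le> C" if "x \<in> K" for n x using ub[of "g n" x] g W0 that by blast
  have u_dec: "u (Suc n) x \<le> u n x" if "x \<in> K" for n x
  proof -
    have "u n x - u (Suc n) x = (1/2)^Suc n * (C - g n x)" by (simp add: u_def v_Suc algebra_simps)
    also have "\<dots> \<ge> 0" using gC[OF that] by simp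
    finally show ?thesis by simp
  qed
  have u_mono: "u m x \<le> u n x" if "x \<in> K" "n \<le> m" for m n x
    using that(2) by (induction rule: dec_induct) (use u_dec[OF that(1)] order_trans in blast)+
  \<comment> \<open>Convexity regroups all later steps into a single competitor for step \<open>n\<close>.\<close>
  have tail: "\<exists>k\<in>W n. (\<lambda>x. v m x + (1/2)^m * h x) = (\<lambda>x. v n x + (1/2)^n * k x)"
    if "n \<le> m" "h \<in> W m" for m n h
    using that
  proof (induction arbitrary: h rule: dec_induct)
    case base then show ?case by blast
  next
    case (step m)
    have "h \<in> W m" using step.prems dec by blast
    from step.IH[OF mid[OF g[of m] this]] show ?case by (simp add: v_Suc field_simps)
  qed
  have pw: "p (w n) \<le> p (w m) + e n" if nm: "n \<le> m" for n m
  proof -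
    obtain k where "k \<in> W n" "w m = (\<lambda>x. v n x + (1/2)^n * k x)"
      using tail[OF nm g[of m]] by (auto simp: w_def)
    with g_min[of k n] show ?thesis by (simp add: w_def)
  qed
  have wu: "w n x \<le> u n x" if "x \<in> K" for n x
    using gC[OF that] by (simp add: w_def u_def)
  have pwu: "p (w n) \<le> p (u n)" for n
    using p_attained[OF cw[of n]] wu p_upper[OF cu[of n]] by (metis order_trans)
  have pu_mono: "p (u m) \<le> p (u n)" if "n \<le> m" for m n
    using p_attained[OF cu[of m]] u_mono[OF _ that] p_upper[OF cu[of n]] by (metis order_trans)
  have key: "p (w n) - e n \<le> p (u m)" for n m
  proof (cases "n \<le> m")
    case True then show ?thesis using pw[OF True] pwu[of m] by linarith
  next
    case False then show ?thesis using pwu[of n] pu_mono[of m n] e_pos[of n] by auto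
  qed
  \<comment> \<open>\<open>s\<close> plays the part of the supremum of the limit \<open>v\<close>, and \<open>b\<close> below that of its maximum point.\<close>
  define s where "s = (SUP n. p (w n) - e n)"
  have s_le: "s \<le> p (u m)" for m
    unfolding s_def by (rule cSUP_least) (use key in auto)
  have s_ge: "p (w n) - e n \<le> s" for n
    unfolding s_def by (rule cSUP_upper) (auto intro!: bdd_aboveI[of _ "p (u 0)"] key)
  have "\<Inter> (range (\<lambda>n. {x\<in>K. s \<le> u n x})) \<noteq> {}"
  proof (rule compact_nest)
    show "compact {x\<in>K. s \<le> u n x}" for n
    proof -
      have "{x\<in>K. s \<le> u n x} = K \<inter> u n -` {s..}" by auto
      moreover have "closedin (top_of_set K) (K \<inter> u n -` {s..})"
        by (rule continuous_closedin_preimage[OF cu]) auto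
      ultimately show ?thesis using K(1) closedin_compact by metis
    qed
    show "{x\<in>K. s \<le> u n x} \<noteq> {}" for n
      using p_attained[OF cu[of n]] s_le[of n] by auto
    show "{x\<in>K. s \<le> u n x} \<subseteq> {x\<in>K. s \<le> u m x}" if "m \<le> n" for m n
      using u_mono[OF _ that] by fastforce
  qed
  then obtain b where b: "b \<in> K" "\<And>n. s \<le> u n b" by auto
  obtain N where N: "\<And>f. f \<in> W N \<Longrightarrow> f b \<le> 0" using ev[OF b(1)] by blast
  have WN: "W m \<subseteq> W N" if "N \<le> m" for m
    using that by (induction rule: dec_induct) (use dec in blast)+
  have vdec: "v m b \<le> v N b" if "N \<le> m" for m
    using that
  proof (induction rule: dec_induct)
    case (step m)
    have "g m b \<le> 0" using N g[of m] WN[OF step.hyps(1)] by blast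
    then have "(1/2)^Suc m * g m b \<le> 0" by (simp add: mult_nonneg_nonpos)
    with step.IH show ?case by (simp add: v_Suc)
  qed simp
  have sv: "s \<le> v N b"
  proof (rule LIMSEQ_le_const)
    have "(\<lambda>m. v N b + (1/2)^m * C) \<longlonglongrightarrow> v N b + 0 * C"
      by (intro tendsto_intros LIMSEQ_power_zero) auto
    then show "(\<lambda>m. v N b + (1/2)^m * C) \<longlonglongrightarrow> v N b" by simp
    show "\<exists>M. \<forall>m\<ge>M. s \<le> v N b + (1/2)^m * C"
    proof (intro exI[of _ N] allI impI)
      fix m assume "N \<le> m"
      then show "s \<le> v N b + (1/2)^m * C" using vdec[of m] b(2)[of m] unfolding u_def by linarith
    qed
  qed
  \<comment> \<open>Since \<open>w n = 2 v (n + 1) - v n\<close>, almost optimality says that the deficit \<open>s - v n b\<close>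
    shrinks by at most a factor 2 in each step.\<close>
  have step: "2 * (s - v (Suc n) b) \<ge> (s - v n b) - e n" for n
  proof -
    have "w n b \<le> s + e n" using p_upper[OF cw b(1), of n] s_ge[of n] by linarith
    then show ?thesis by (simp add: w_def v_Suc field_simps)
  qed
  have "2^n * (s - v n b) \<ge> s - \<eta>/2 + \<eta>/2 * (1/2)^n" for n
  proof (induction n)
    case 0 then show ?case by (simp add: v0)
  next
    case (Suc n)
    have "2^n * e n = \<eta>/4 * (1/2)^n"
      by (simp add: e_def power_mult_distrib[symmetric])
    moreover have "2^n * (2 * (s - v (Suc n) b)) \<ge> 2^n * ((s - v n b) - e n)"
      using step by (intro mult_left_mono) auto
    ultimately show ?case using Suc.IH by (simp add: algebra_simps)
  qed
  from this[of N] have "s - \<eta>/2 + \<eta>/2 * (1/2)^N \<le> 2^N * (s - v N b)" .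
  moreover have "2^N * (s - v N b) \<le> 0" using sv by (simp add: mult_nonneg_nonpos)
  moreover have "\<eta>/2 * (1/2)^N > 0" using \<eta> by simp
  moreover have "s \<ge> \<eta> - \<eta>/4"
  proof -
    obtain x where "x \<in> K" "\<eta> \<le> w 0 x" using big[OF w0] by blast
    then show ?thesis using p_upper[OF cw, of x 0] s_ge[of 0] by (simp add: e_def)
  qed
  ultimately show False using \<eta> by linarith
qed

text \<open>
  The previous lemma yields functions below any \<open>\<eta> > 0\<close>, not below 0. Apply it once to find in each
  \<open>W n\<close> functions \<open>f < 1 / (n + 1)\<close>, and then a second time to the rescaled functions \<open>c f + 1\<close> with
  \<open>c \<ge> n + 1\<close> and \<open>c f \<le> 1\<close>. Rescaling keeps the upper bound but drives the values at each point
  to \<open>- \<infinity>\<close>, so that the second application gives \<open>c f + 1 < 1/2\<close>.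
\<close>

lemma compact_convex_family_negative:
  fixes W :: "nat \<Rightarrow> ('k::heine_borel \<Rightarrow> real) set"
  assumes K: "compact K" "K \<noteq> {}"
    and ne: "\<And>n. W n \<noteq> {}"
    and dec: "\<And>n. W (Suc n) \<subseteq> W n"
    and cvx: "\<And>n f g t. f \<in> W n \<Longrightarrow> g \<in> W n \<Longrightarrow> 0 \<le> t \<Longrightarrow> t \<le> 1 \<Longrightarrow>
               (\<lambda>x. t * f x + (1 - t) * g x) \<in> W n"
    and cont: "\<And>f. f \<in> W 0 \<Longrightarrow> continuous_on K f"
    and ub: "\<And>f x. f \<in> W 0 \<Longrightarrow> x \<in> K \<Longrightarrow> f x \<le> C"
    and ev: "\<And>x. x \<in> K \<Longrightarrow> \<exists>\<delta>>0. \<exists>n. \<forall>f\<in>W n. f x \<le> - \<delta>"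
  shows "\<exists>f\<in>W 0. \<forall>x\<in>K. f x < 0"
proof -
  have W_mono: "W n \<subseteq> W m" if "m \<le> n" for m n
    using that by (induction rule: dec_induct) (use dec in blast)+
  have small: "\<exists>f\<in>W n. \<forall>x\<in>K. f x < \<eta>" if "\<eta> > 0" for n \<eta>
  proof -
    have "\<exists>f\<in>W (0 + n). \<forall>x\<in>K. f x < \<eta>"
    proof (rule compact_convex_family_less[OF K, where W = "\<lambda>m. W (m + n)" and C = C])
      show "continuous_on K f" if "f \<in> W (0 + n)" for f
        using cont W_mono[of 0 n] that by auto
      show "f x \<le> C" if "f \<in> W (0 + n)" "x \<in> K" for f x
        using ub W_mono[of 0 n] that by auto
      show "\<exists>m. \<forall>f\<in>W (m + n). f x \<le> 0" if x: "x \<in> K" for x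
      proof -
        obtain \<delta> m where "\<delta> > 0" "\<forall>f\<in>W m. f x \<le> - \<delta>" using ev[OF x] by blast
        moreover have "W (m + n) \<subseteq> W m" by (rule W_mono) simp
        ultimately show ?thesis by (intro exI[of _ m]) fastforce
      qed
    qed (use ne dec cvx \<open>\<eta> > 0\<close> in auto)
    then show ?thesis by simp
  qed
  define V where "V n = {(\<lambda>x. c * f x + 1) |c f. real n + 1 \<le> c \<and> f \<in> W n \<and> (\<forall>x\<in>K. c * f x \<le> 1)}" for n
  have "\<exists>h\<in>V 0. \<forall>x\<in>K. h x < 1/2"
  proof (rule compact_convex_family_less[OF K, where C = 2])
    show "V n \<noteq> {}" for n
    proof -
      obtain f where f: "f \<in> W n" "\<forall>x\<in>K. f x < 1 / (real n + 1)"
        using small[of "1 / (real n + 1)" n] by auto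
      then have "\<forall>x\<in>K. (real n + 1) * f x \<le> 1" by (auto simp: field_simps less_imp_le)
      with f show ?thesis unfolding V_def by blast
    qed
    show "V (Suc n) \<subseteq> V n" for n
      unfolding V_def using dec by fastforce
    show "(\<lambda>x. t * f x + (1 - t) * g x) \<in> V n"
      if fg: "f \<in> V n" "g \<in> V n" and t: "0 \<le> t" "t \<le> 1" for n f g t
    proof -
      obtain c f' where f: "f = (\<lambda>x. c * f' x + 1)" "real n + 1 \<le> c" "f' \<in> W n" "\<forall>x\<in>K. c * f' x \<le> 1"
        using fg(1) by (auto simp: V_def)
      obtain d g' where g: "g = (\<lambda>x. d * g' x + 1)" "real n + 1 \<le> d" "g' \<in> W n" "\<forall>x\<in>K. d * g' x \<le> 1"
        using fg(2) by (auto simp: V_def)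
      define a where "a = t * c + (1 - t) * d"
      have "t * (real n + 1) + (1 - t) * (real n + 1) \<le> a"
        unfolding a_def using t f(2) g(2) by (intro add_mono mult_left_mono) auto
      then have a: "real n + 1 \<le> a" by (simp add: algebra_simps)
      then have a0: "a > 0" by linarith
      define k where "k = (\<lambda>x. (t * c / a) * f' x + (1 - t * c / a) * g' x)"
      have "0 \<le> t * c / a" using t f(2) a0 by auto
      moreover have "t * c / a \<le> 1"
        using t g(2) a0 by (auto simp: a_def divide_le_eq_1)
      ultimately have k: "k \<in> W n" unfolding k_def by (intro cvx f g)
      have ak: "a * k x = t * (c * f' x) + (1 - t) * (d * g' x)" for x
      proof -
        have "a * k x = t * c * f' x + (a - t * c) * g' x"
          using a0 by (simp add: k_def field_simps)
        then show ?thesis by (simp add: a_def)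
      qed
      have "a * k x \<le> 1" if "x \<in> K" for x
      proof -
        have "t * (c * f' x) + (1 - t) * (d * g' x) \<le> t * 1 + (1 - t) * 1"
          using t f(4) g(4) that by (intro add_mono mult_left_mono) auto
        then show ?thesis by (simp add: ak)
      qed
      moreover have "(\<lambda>x. t * f x + (1 - t) * g x) = (\<lambda>x. a * k x + 1)"
        by (simp add: f(1) g(1) ak algebra_simps)
      ultimately show ?thesis unfolding V_def using a k by blast
    qed
    show "continuous_on K f" if "f \<in> V 0" for f
      using that cont unfolding V_def by (auto intro!: continuous_intros)
    show "f x \<le> 2" if "f \<in> V 0" "x \<in> K" for f x
      using that unfolding V_def by auto
    show "\<exists>n. \<forall>f\<in>V n. f x \<le> 0" if x: "x \<in> K" for x
    proof -
      obtain \<delta> m where \<delta>: "\<delta> > 0" "\<And>f. f \<in> W m \<Longrightarrow> f x \<le> - \<delta>" using ev[OF x] by blast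
      obtain k :: nat where k: "1 / \<delta> < real k" using reals_Archimedean2 by blast
      have "c * f x + 1 \<le> 0" if "f \<in> W (m + k)" "real (m + k) + 1 \<le> c" for c f
      proof -
        have c: "1 / \<delta> \<le> c" "0 \<le> c" using k that(2) by auto
        have "f x \<le> - \<delta>" using \<delta>(2) W_mono[of m "m+k"] that(1) by auto
        then have "c * f x \<le> c * - \<delta>" using c by (intro mult_left_mono)
        moreover have "c * \<delta> \<ge> 1" using c(1) \<delta>(1) by (simp add: field_simps)
        ultimately show ?thesis by simp
      qed
      then show ?thesis by (intro exI[of _ "m + k"]) (auto simp: V_def)
    qed
  qed simp
  then obtain c f where "1 \<le> c" "f \<in> W 0" "\<forall>x\<in>K. c * f x + 1 < 1/2"
    by (auto simp: V_def)
  moreover from this have "f x < 0" if "x \<in> K" for x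
  proof -
    have "c * f x < 0" using that calculation by force
    then show ?thesis using \<open>1 \<le> c\<close> by (simp add: mult_less_0_iff)
  qed
  ultimately show ?thesis by blast
qed

section \<open>Mollification on a box\<close>

text \<open>
  The square makes the truncated paraboloid continuously differentiable while its support stays
  in \<open>cball c r\<close>.
\<close>

definition bump :: "'a::euclidean_space \<Rightarrow> real \<Rightarrow> 'a \<Rightarrow> real" where
  "bump c r y = (max 0 (r\<^sup>2 - (y - c) \<bullet> (y - c)))\<^sup>2"

definition bump_deriv :: "'a::euclidean_space \<Rightarrow> real \<Rightarrow> 'a \<Rightarrow> 'a \<Rightarrow> real" where
  "bump_deriv c r y v = - 4 * max 0 (r\<^sup>2 - (y - c) \<bullet> (y - c)) * ((y - c) \<bullet> v)"

lemma has_real_derivative_positive_part_squared: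
  "((\<lambda>t::real. (max 0 t)\<^sup>2) has_real_derivative 2 * max 0 t) (at t)"
proof -
  consider "t < 0" | "t = 0" | "t > 0" by linarith
  then show ?thesis
  proof cases
    case 1
    have "((\<lambda>t::real. (max 0 t)\<^sup>2) has_real_derivative 0) (at t)"
      by (rule has_field_derivative_transform_within_open[of "\<lambda>_. 0" _ _ "{..<0}"]) (use 1 in auto)
    with 1 show ?thesis by simp
  next
    case 2
    have "((\<lambda>h::real. (max 0 h)\<^sup>2 / h) \<longlongrightarrow> 0) (at 0)"
    proof (rule Lim_null_comparison)
      show "\<forall>\<^sub>F h::real in at 0. norm ((max 0 h)\<^sup>2 / h) \<le> \<bar>h\<bar>"
        by (auto intro!: always_eventually simp: power2_eq_square max_def)
      show "((\<lambda>h::real. \<bar>h\<bar>) \<longlongrightarrow> 0) (at 0)" by (auto intro!: tendsto_eq_intros)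
    qed
    with 2 show ?thesis by (simp add: DERIV_def)
  next
    case 3
    have "((\<lambda>t::real. (max 0 t)\<^sup>2) has_real_derivative 2 * t) (at t)"
      by (rule has_field_derivative_transform_within_open[of "\<lambda>t. t^2" _ _ "{0<..}"])
         (use 3 in \<open>auto intro!: derivative_eq_intros\<close>)
    with 3 show ?thesis by simp
  qed
qed

lemma has_derivative_bump: "(bump c r has_derivative bump_deriv c r y) (at y)"
proof -
  have "((\<lambda>y. (max 0 (r\<^sup>2 - (y - c) \<bullet> (y - c)))\<^sup>2) has_derivative
     (\<lambda>v. (0 - ((y - c) \<bullet> v + v \<bullet> (y - c))) * (2 * max 0 (r\<^sup>2 - (y - c) \<bullet> (y - c))))) (at y)"
    by (rule has_derivative_in_compose2[where t = UNIV and f = "\<lambda>y. r\<^sup>2 - (y - c) \<bullet> (y - c)" and g = "\<lambda>t. (max 0 t)\<^sup>2"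
          and g' = "\<lambda>t s. s * (2 * max 0 t)"])
       (use has_real_derivative_positive_part_squared in
         \<open>auto intro!: derivative_eq_intros simp: has_field_derivative_def mult_commute_abs algebra_simps\<close>)
  then show ?thesis
    by (simp add: bump_def[abs_def] bump_deriv_def[abs_def] inner_commute algebra_simps)
qed

lemma bump_nonneg: "0 \<le> bump c r y"
  by (simp add: bump_def)

lemma bump_eq_0: "0 \<le> r \<Longrightarrow> y \<notin> cball c r \<Longrightarrow> bump c r y = 0"
  and bump_deriv_eq_0: "0 \<le> r \<Longrightarrow> y \<notin> cball c r \<Longrightarrow> bump_deriv c r y v = 0"
proof -
  assume "0 \<le> r" "y \<notin> cball c r"
  then have "r < norm (y - c)" by (simp add: dist_norm norm_minus_commute)
  then have "r\<^sup>2 < (y - c) \<bullet> (y - c)"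
    using \<open>0 \<le> r\<close> by (simp add: power_strict_mono dot_square_norm)
  then show "bump c r y = 0" "bump_deriv c r y v = 0" by (auto simp: bump_def bump_deriv_def)
qed

lemma continuous_on_bump [continuous_intros]:
  "continuous_on S f \<Longrightarrow> continuous_on S (\<lambda>x. bump c r (f x))"
  unfolding bump_def by (intro continuous_intros)

lemma continuous_on_bump_deriv [continuous_intros]:
  "continuous_on S f \<Longrightarrow> continuous_on S (\<lambda>x. bump_deriv c r (f x) v)"
  unfolding bump_deriv_def by (intro continuous_intros)

lemma shrink_mem_cbox:
  fixes a b :: "'a::euclidean_space"
  assumes "\<theta> \<in> cbox a b" "y \<in> cbox a b" "0 \<le> h" "h \<le> 1"
  shows "(1 - h) *\<^sub>R \<theta> + h *\<^sub>R y \<in> cbox a b"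
  using assms convex_box(1)[of a b] by (simp add: convex_alt)

text \<open>
  The same average in two forms. On the left \<open>\<theta>\<close> occurs only in the smooth kernel, so one can
  differentiate under the integral sign although \<open>F\<close> is merely continuous; on the right \<open>\<theta>\<close> occurs only
  in \<open>F\<close>, so bounds on \<open>F\<close> pass to the average.
\<close>

lemma integral_rescaled_kernel:
  fixes a b c \<theta> :: "'a::euclidean_space" and F :: "'a \<Rightarrow> 'b::banach"
  assumes F: "continuous_on (cbox a b) F"
    and k: "continuous_on UNIV k" "\<And>y. y \<notin> cball c r \<Longrightarrow> k y = (0::real)" "cball c r \<subseteq> cbox a b"
    and \<theta>: "\<theta> \<in> cbox a b" and h: "0 < h" "h \<le> 1"
  shows "integral (cbox a b) (\<lambda>z. k ((1/h) *\<^sub>R (z - (1 - h) *\<^sub>R \<theta>)) *\<^sub>R F z) =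
         h ^ DIM('a) *\<^sub>R integral (cbox a b) (\<lambda>y. k y *\<^sub>R F ((1 - h) *\<^sub>R \<theta> + h *\<^sub>R y))" (is "?I = _ *\<^sub>R integral _ ?g")
proof -
  let ?f = "\<lambda>z. k ((1/h) *\<^sub>R (z - (1 - h) *\<^sub>R \<theta>)) *\<^sub>R F z"
  let ?S = "(\<lambda>x. (1 / h) *\<^sub>R x + -((1 / h) *\<^sub>R ((1 - h) *\<^sub>R \<theta>))) ` cbox a b"
  have "?f integrable_on cbox a b"
    by (intro integrable_continuous continuous_intros F continuous_on_compose2[OF k(1)]) auto
  then have "(?f has_integral ?I) (cbox a b)" by (rule integrable_integral)
  from has_integral_affinity[OF this, of h "(1 - h) *\<^sub>R \<theta>"] h
  have "((\<lambda>y. k y *\<^sub>R F (h *\<^sub>R y + (1 - h) *\<^sub>R \<theta>)) has_integral (1 / h ^ DIM('a)) *\<^sub>R ?I) ?S"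
    by simp
  then have "(?g has_integral (1 / h ^ DIM('a)) *\<^sub>R ?I) ?S"
    by (simp add: add.commute)
  moreover have "cbox a b \<subseteq> ?S"
  proof
    fix y assume "y \<in> cbox a b"
    then have "(1 - h) *\<^sub>R \<theta> + h *\<^sub>R y \<in> cbox a b" using \<theta> h by (intro shrink_mem_cbox) auto
    moreover have "y = (1 / h) *\<^sub>R ((1 - h) *\<^sub>R \<theta> + h *\<^sub>R y) + -((1 / h) *\<^sub>R ((1 - h) *\<^sub>R \<theta>))"
      using h by (simp add: scaleR_add_right)
    ultimately show "y \<in> ?S" by blast
  qed
  moreover have "?g y = 0" if "y \<notin> cbox a b" for y
    using k(2)[of y] k(3) that by (metis scaleR_zero_left subsetD)
  ultimately have "(?g has_integral (1 / h ^ DIM('a)) *\<^sub>R ?I) (cbox a b)"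
    by (subst (asm) has_integral_restrict_UNIV[symmetric], subst has_integral_restrict_UNIV[symmetric])
       (smt (verit) has_integral_eq subsetD)
  then have "integral (cbox a b) ?g = (1 / h ^ DIM('a)) *\<^sub>R ?I" by (rule integral_unique)
  then show ?thesis using h by simp
qed

text \<open>
  The point \<open>(1 - h) \<theta> + h y\<close> lies in the box whenever \<open>\<theta>\<close> and \<open>y\<close> do. Averaging over these points,
  rather than over a neighbourhood of \<open>\<theta>\<close>, avoids extending \<open>F\<close> beyond the box.
\<close>

definition bump_average ::
  "'a::euclidean_space \<Rightarrow> 'a \<Rightarrow> 'a \<Rightarrow> real \<Rightarrow> real \<Rightarrow> ('a \<Rightarrow> 'b::euclidean_space) \<Rightarrow> 'a \<Rightarrow> 'b" where
  "bump_average a b c r h F \<theta> = (1 / integral (cbox a b) (bump c r)) *\<^sub>R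
     integral (cbox a b) (\<lambda>y. bump c r y *\<^sub>R F ((1 - h) *\<^sub>R \<theta> + h *\<^sub>R y))"

text \<open>
  The factor \<open>- (1 - h) / h\<close> is the derivative of \<open>(z - (1 - h) \<theta>) / h\<close>, the argument of the
  rescaled kernel, with respect to \<open>\<theta>\<close>.
\<close>

definition bump_average_deriv ::
  "'a::euclidean_space \<Rightarrow> 'a \<Rightarrow> 'a \<Rightarrow> real \<Rightarrow> real \<Rightarrow> ('a \<Rightarrow> 'b::euclidean_space) \<Rightarrow> 'a \<Rightarrow> 'a \<Rightarrow> 'b" where
  "bump_average_deriv a b c r h F \<theta> v = (- ((1 - h) / h) / integral (cbox a b) (bump c r)) *\<^sub>R
     integral (cbox a b) (\<lambda>y. bump_deriv c r y v *\<^sub>R F ((1 - h) *\<^sub>R \<theta> + h *\<^sub>R y))"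

locale box_mollifier =
  fixes a b c :: "'a::euclidean_space" and r :: real
  assumes r: "0 < r" and ball: "cball c r \<subseteq> cbox a b"
begin

abbreviation mass :: real where "mass \<equiv> integral (cbox a b) (bump c r)"

lemma shift_continuous:
  assumes "continuous_on (cbox a b) F" "0 \<le> h" "h \<le> 1" "\<theta> \<in> cbox a b"
  shows "continuous_on (cbox a b) (\<lambda>y. F ((1 - h) *\<^sub>R \<theta> + h *\<^sub>R y))"
  by (rule continuous_on_compose2[OF assms(1)])
     (use assms in \<open>auto intro!: continuous_intros shrink_mem_cbox\<close>)

lemma box_ne: "box a b \<noteq> {}"
proof -
  have "ball c r \<subseteq> interior (cbox a b)"
    by (rule interior_maximal) (use ball ball_subset_cball in auto)
  then show ?thesis using r by (auto simp: interior_cbox)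
qed

lemma mass_pos: "0 < mass"
proof -
  have "0 \<le> mass" by (intro integral_nonneg integrable_continuous continuous_intros) (simp add: bump_nonneg)
  moreover have "mass \<noteq> 0"
  proof
    assume "mass = 0"
    moreover have "c \<in> cbox a b" using ball r by auto
    moreover note box_ne
    moreover have "\<And>x. 0 \<le> bump c r x" by (rule bump_nonneg)
    ultimately have "bump c r c = 0"
      using integral_cbox_eq_0_iff[of a b "bump c r"] continuous_on_bump[OF continuous_on_id] by blast
    then show False using r by (simp add: bump_def)
  qed
  ultimately show ?thesis by simp
qed

lemma has_derivative_bump_average:
  fixes F :: "'a \<Rightarrow> 'b::euclidean_space"
  assumes F: "continuous_on (cbox a b) F" and h: "0 < h" "h \<le> 1" and \<theta>: "\<theta> \<in> cbox a b"
  shows "(bump_average a b c r h F has_derivative bump_average_deriv a b c r h F \<theta>) (at \<theta> within cbox a b)"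
proof -
  let ?w = "\<lambda>\<theta> z. (1/h) *\<^sub>R (z - (1 - h) *\<^sub>R \<theta>)"
  define fx where "fx \<theta> z = (4 * ((1 - h) / h) * max 0 (r\<^sup>2 - (?w \<theta> z - c) \<bullet> (?w \<theta> z - c))) *\<^sub>R
     (blinfun_scaleR_left (F z) o\<^sub>L blinfun_inner_right (?w \<theta> z - c))" for \<theta> z
  have fx: "blinfun_apply (fx \<theta> z) v = (- ((1 - h) / h)) *\<^sub>R (bump_deriv c r (?w \<theta> z) v *\<^sub>R F z)" for \<theta> z v
    by (simp add: fx_def bump_deriv_def blinfun.bilinear_simps field_simps)
  have cfx: "continuous_on (cbox a b \<times> cbox a b) (\<lambda>(\<theta>, z). fx \<theta> z)"
    unfolding fx_def split_beta
    by (intro continuous_intros continuous_on_compose2[OF F]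
          bounded_linear.continuous_on[OF bounded_linear_blinfun_inner_right]
          bounded_linear.continuous_on[OF bounded_linear_blinfun_scaleR_left]
          bounded_bilinear.continuous_on[OF bounded_bilinear_blinfun_compose]) auto
  let ?G = "\<lambda>\<theta>. integral (cbox a b) (\<lambda>z. bump c r (?w \<theta> z) *\<^sub>R F z)"
  have "(?G has_derivative integral (cbox a b) (fx \<theta>)) (at \<theta> within cbox a b)"
  proof (rule leibniz_rule[OF _ _ cfx \<theta> convex_box(1)])
    fix \<theta> z assume \<theta>: "\<theta> \<in> cbox a b"
    have "((\<lambda>\<theta>. bump c r (?w \<theta> z)) has_derivative (\<lambda>v. bump_deriv c r (?w \<theta> z) (- ((1-h)/h) *\<^sub>R v))) (at \<theta> within cbox a b)"
      by (rule has_derivative_in_compose2[where t = UNIV and g = "bump c r" and g' = "bump_deriv c r"])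
         (use \<theta> in \<open>auto intro!: derivative_eq_intros has_derivative_at_withinI[OF has_derivative_bump]\<close>)
    from has_derivative_scaleR_left[OF this, of "F z"]
    show "((\<lambda>\<theta>. bump c r (?w \<theta> z) *\<^sub>R F z) has_derivative blinfun_apply (fx \<theta> z)) (at \<theta> within cbox a b)"
      by (rule has_derivative_eq_rhs) (auto simp: fun_eq_iff fx bump_deriv_def)
    show "(\<lambda>z. bump c r (?w \<theta> z) *\<^sub>R F z) integrable_on cbox a b"
      by (intro integrable_continuous continuous_intros F)
  qed
  then have "((\<lambda>\<theta>. (1 / (mass * h ^ DIM('a))) *\<^sub>R ?G \<theta>) has_derivative
     (\<lambda>v. (1 / (mass * h ^ DIM('a))) *\<^sub>R blinfun_apply (integral (cbox a b) (fx \<theta>)) v)) (at \<theta> within cbox a b)"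
    by (rule has_derivative_scaleR_right)
  moreover have "(1 / (mass * h ^ DIM('a))) *\<^sub>R blinfun_apply (integral (cbox a b) (fx \<theta>)) v
      = bump_average_deriv a b c r h F \<theta> v" for v
  proof -
    have "continuous_on (cbox a b) (fx \<theta>)"
    proof -
      have "continuous_on (cbox a b) (\<lambda>z. case (\<theta>, z) of (\<theta>, z) \<Rightarrow> fx \<theta> z)"
        by (rule continuous_on_compose2[OF cfx])
           (use \<theta> in \<open>auto intro: continuous_on_Pair[OF continuous_on_const continuous_on_id]\<close>)
      then show ?thesis by simp
    qed
    then have "fx \<theta> integrable_on cbox a b" by (rule integrable_continuous)
    then have "blinfun_apply (integral (cbox a b) (fx \<theta>)) v =
       (- ((1 - h) / h)) *\<^sub>R integral (cbox a b) (\<lambda>z. bump_deriv c r (?w \<theta> z) v *\<^sub>R F z)"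
      by (simp only: blinfun_apply_integral fx integral_cmul)
    also have "\<dots> = (- ((1 - h) / h)) *\<^sub>R h ^ DIM('a) *\<^sub>R
        integral (cbox a b) (\<lambda>y. bump_deriv c r y v *\<^sub>R F ((1 - h) *\<^sub>R \<theta> + h *\<^sub>R y))"
      using r by (subst integral_rescaled_kernel[where r = r and c = c, OF F _ _ ball \<theta> h])
        (auto intro!: continuous_intros bump_deriv_eq_0)
    finally show ?thesis using h mass_pos by (simp add: bump_average_deriv_def)
  qed
  moreover have "(1 / (mass * h ^ DIM('a))) *\<^sub>R ?G \<theta>' = bump_average a b c r h F \<theta>'" if "\<theta>' \<in> cbox a b" for \<theta>'
    using h r by (subst integral_rescaled_kernel[where r = r and c = c, OF F _ _ ball that h])
      (auto intro!: continuous_intros bump_eq_0 simp: bump_average_def)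
  ultimately have "((\<lambda>\<theta>. (1 / (mass * h ^ DIM('a))) *\<^sub>R ?G \<theta>) has_derivative bump_average_deriv a b c r h F \<theta>)
      (at \<theta> within cbox a b)"
    and avg: "\<And>\<theta>'. \<theta>' \<in> cbox a b \<Longrightarrow> (1 / (mass * h ^ DIM('a))) *\<^sub>R ?G \<theta>' = bump_average a b c r h F \<theta>'"
    by (simp_all only:)
  from has_derivative_transform[OF \<theta> avg[symmetric] this(1)] show ?thesis .
qed

lemma continuous_on_bump_average_deriv:
  fixes F :: "'a \<Rightarrow> 'b::euclidean_space"
  assumes F: "continuous_on (cbox a b) F" and h: "0 < h" "h \<le> 1"
  shows "continuous_on (cbox a b) (\<lambda>\<theta>. bump_average_deriv a b c r h F \<theta> v)"
  unfolding bump_average_deriv_def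
  by (intro continuous_intros integral_continuous_on_param)
     (use h in \<open>auto simp: split_beta intro!: continuous_intros continuous_on_compose2[OF F] shrink_mem_cbox\<close>)

lemma kernel_shift_integrable:
  fixes F :: "'a \<Rightarrow> 'b::euclidean_space"
  assumes "continuous_on (cbox a b) F" "0 \<le> h" "h \<le> 1" "\<theta> \<in> cbox a b" "continuous_on (cbox a b) k"
  shows "(\<lambda>y. k y *\<^sub>R F ((1 - h) *\<^sub>R \<theta> + h *\<^sub>R y)) integrable_on cbox a b"
  by (intro integrable_continuous continuous_on_scaleR shift_continuous assms)

lemma integral_bump_scaleR: "integral (cbox a b) (\<lambda>y. bump c r y *\<^sub>R u) = mass *\<^sub>R (u::'b::euclidean_space)"
  by (intro integral_unique has_integral_scaleR_left integrable_integral integrable_continuous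
        continuous_on_bump continuous_on_id)

lemma bounded_linear_bump_average_ge:
  fixes F :: "'a \<Rightarrow> 'b::euclidean_space"
  assumes F: "continuous_on (cbox a b) F" and h: "0 \<le> h" "h \<le> 1" and \<theta>: "\<theta> \<in> cbox a b"
    and l: "bounded_linear l" and ge: "\<And>z. z \<in> cbox a b \<Longrightarrow> m \<le> (l (F z) :: real)"
  shows "m \<le> l (bump_average a b c r h F \<theta>)"
proof -
  note int = kernel_shift_integrable[OF F h \<theta>, of "bump c r"]
  have "m * mass = integral (cbox a b) (\<lambda>y. bump c r y * m)" by (simp add: mult.commute)
  also have "\<dots> \<le> integral (cbox a b) (\<lambda>y. l (bump c r y *\<^sub>R F ((1 - h) *\<^sub>R \<theta> + h *\<^sub>R y)))"
  proof (rule integral_le)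
    show "(\<lambda>y. bump c r y * m) integrable_on cbox a b"
      by (intro integrable_continuous continuous_intros)
    show "(\<lambda>y. l (bump c r y *\<^sub>R F ((1 - h) *\<^sub>R \<theta> + h *\<^sub>R y))) integrable_on cbox a b"
      using integrable_linear[OF int l] by (simp add: o_def continuous_on_bump)
    show "bump c r y * m \<le> l (bump c r y *\<^sub>R F ((1 - h) *\<^sub>R \<theta> + h *\<^sub>R y))" if "y \<in> cbox a b" for y
      using ge[OF shrink_mem_cbox[OF \<theta> that h]] bump_nonneg[of c r y]
      by (simp add: linear_simps[OF l] mult_left_mono)
  qed
  also have "\<dots> = l (integral (cbox a b) (\<lambda>y. bump c r y *\<^sub>R F ((1 - h) *\<^sub>R \<theta> + h *\<^sub>R y)))"
    using integral_linear[OF int l] by (simp add: o_def continuous_on_bump)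
  finally show ?thesis
    using mass_pos by (simp add: bump_average_def linear_simps[OF l] field_simps)
qed

lemma bump_average_diff:
  fixes F G :: "'a \<Rightarrow> 'b::euclidean_space"
  assumes "continuous_on (cbox a b) F" "continuous_on (cbox a b) G" "0 \<le> h" "h \<le> 1" "\<theta> \<in> cbox a b"
  shows "bump_average a b c r h (\<lambda>z. F z - G z) \<theta> = bump_average a b c r h F \<theta> - bump_average a b c r h G \<theta>"
    and "bump_average_deriv a b c r h (\<lambda>z. F z - G z) \<theta> v
         = bump_average_deriv a b c r h F \<theta> v - bump_average_deriv a b c r h G \<theta> v"
proof -
  have "integral (cbox a b) (\<lambda>y. k y *\<^sub>R (F ((1 - h) *\<^sub>R \<theta> + h *\<^sub>R y) - G ((1 - h) *\<^sub>R \<theta> + h *\<^sub>R y)))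
      = integral (cbox a b) (\<lambda>y. k y *\<^sub>R F ((1 - h) *\<^sub>R \<theta> + h *\<^sub>R y))
        - integral (cbox a b) (\<lambda>y. k y *\<^sub>R G ((1 - h) *\<^sub>R \<theta> + h *\<^sub>R y))"
    if "continuous_on (cbox a b) k" for k
    unfolding scaleR_diff_right by (intro integral_diff kernel_shift_integrable assms that)
  from this[of "bump c r"] this[of "\<lambda>y. bump_deriv c r y v"]
  show "bump_average a b c r h (\<lambda>z. F z - G z) \<theta> = bump_average a b c r h F \<theta> - bump_average a b c r h G \<theta>"
    and "bump_average_deriv a b c r h (\<lambda>z. F z - G z) \<theta> v
         = bump_average_deriv a b c r h F \<theta> v - bump_average_deriv a b c r h G \<theta> v"
    by (simp_all only: bump_average_def bump_average_deriv_def scaleR_diff_right[symmetric]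
          continuous_on_bump[OF continuous_on_id] continuous_on_bump_deriv[OF continuous_on_id])
qed

lemma norm_bump_average_diff_le:
  fixes F :: "'a \<Rightarrow> 'b::euclidean_space"
  assumes F: "continuous_on (cbox a b) F" and h: "0 \<le> h" "h \<le> 1" and \<theta>: "\<theta> \<in> cbox a b"
    and near: "\<And>y. y \<in> cbox a b \<Longrightarrow> norm (F ((1 - h) *\<^sub>R \<theta> + h *\<^sub>R y) - u) \<le> e"
  shows "norm (bump_average a b c r h F \<theta> - u) \<le> e"
proof -
  have "bump_average a b c r h (\<lambda>z. u) \<theta> = u"
    using mass_pos by (simp add: bump_average_def integral_bump_scaleR)
  then have "bump_average a b c r h F \<theta> - u = bump_average a b c r h (\<lambda>z. F z - u) \<theta>"
    using bump_average_diff(1)[OF F continuous_on_const h \<theta>, of u] by simp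
  also have "norm \<dots> \<le> (1 / mass) * integral (cbox a b) (\<lambda>y. bump c r y * e)"
    unfolding bump_average_def norm_scaleR using mass_pos
    by (intro mult_mono integral_norm_bound_integral kernel_shift_integrable integrable_continuous
          continuous_intros F h \<theta>)
       (use near in \<open>auto intro!: mult_left_mono simp: bump_nonneg integral_nonneg\<close>)
  also have "\<dots> = e" using mass_pos by (simp add: mult.commute)
  finally show ?thesis .
qed

text \<open>Since the box is bounded, the points \<open>(1 - h) \<theta> + h y\<close> come close to \<open>\<theta>\<close> uniformly in \<open>y\<close>.\<close>

lemma tendsto_bump_average:
  fixes F :: "'a \<Rightarrow> 'b::euclidean_space"
  assumes F: "continuous_on (cbox a b) F" and \<theta>: "\<theta> \<in> cbox a b"
  shows "((\<lambda>h. bump_average a b c r h F \<theta>) \<longlongrightarrow> F \<theta>) (at_right 0)"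
proof (rule tendstoI)
  fix e :: real assume e: "e > 0"
  obtain d where d: "d > 0" "\<And>z. z \<in> cbox a b \<Longrightarrow> dist z \<theta> < d \<Longrightarrow> dist (F z) (F \<theta>) < e/2"
    using F \<theta> e by (metis continuous_on_iff half_gt_zero)
  obtain B where B: "B > 0" "\<And>y. y \<in> cbox a b \<Longrightarrow> norm (y - \<theta>) \<le> B"
    using bounded_pos[of "(\<lambda>y. y - \<theta>) ` cbox a b"] bounded_minus_comp by (force simp: bounded_translation_minus)
  have "\<forall>\<^sub>F h in at_right 0. h \<in> {0<..<min (d / B) 1}"
    using d B by (intro eventually_at_right_real) auto
  then show "\<forall>\<^sub>F h in at_right 0. dist (bump_average a b c r h F \<theta>) (F \<theta>) < e"
  proof eventually_elim
    case (elim h)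
    have "norm (bump_average a b c r h F \<theta> - F \<theta>) \<le> e/2"
    proof (rule norm_bump_average_diff_le[OF F])
      fix y assume y: "y \<in> cbox a b"
      have eq: "(1 - h) *\<^sub>R \<theta> + h *\<^sub>R y - \<theta> = h *\<^sub>R (y - \<theta>)" by (simp add: algebra_simps)
      have "norm (h *\<^sub>R (y - \<theta>)) \<le> h * B" using B(2)[OF y] elim by (simp add: mult_left_mono)
      also have "\<dots> < d" using elim B by (simp add: field_simps)
      finally have "dist ((1 - h) *\<^sub>R \<theta> + h *\<^sub>R y) \<theta> < d" by (simp add: dist_norm eq)
      then show "norm (F ((1 - h) *\<^sub>R \<theta> + h *\<^sub>R y) - F \<theta>) \<le> e/2"
        using d(2) shrink_mem_cbox[OF \<theta> y] elim by (simp add: dist_norm less_imp_le)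
    qed (use elim \<theta> in auto)
    then show ?case using e by (simp add: dist_norm)
  qed
qed

text \<open>
  Averaging an affine map gives an affine map with linear part \<open>(1 - h) L\<close>. Uniqueness of the
  derivative then evaluates the kernel integral, with no integration by parts.
\<close>

lemma bump_average_deriv_affine:
  fixes L :: "'a \<Rightarrow> 'b::euclidean_space"
  assumes L: "bounded_linear L" and h: "0 < h" "h \<le> 1" and \<theta>: "\<theta> \<in> cbox a b"
  shows "bump_average_deriv a b c r h (\<lambda>z. u + L z) \<theta> v = (1 - h) *\<^sub>R L v"
proof -
  note [continuous_intros] = linear_continuous_on[OF L]
  define w where "w = (1 / mass) *\<^sub>R integral (cbox a b) (\<lambda>y. bump c r y *\<^sub>R L y)"
  have "bump_average a b c r h (\<lambda>z. u + L z) = (\<lambda>\<theta>. u + (1 - h) *\<^sub>R L \<theta> + h *\<^sub>R w)"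
  proof
    fix \<theta>
    have "integral (cbox a b) (\<lambda>y. bump c r y *\<^sub>R (u + L ((1 - h) *\<^sub>R \<theta> + h *\<^sub>R y)))
        = integral (cbox a b) (\<lambda>y. bump c r y *\<^sub>R (u + (1 - h) *\<^sub>R L \<theta>) + h *\<^sub>R (bump c r y *\<^sub>R L y))"
      by (simp add: linear_simps[OF L] algebra_simps)
    also have "\<dots> = mass *\<^sub>R (u + (1 - h) *\<^sub>R L \<theta>) + h *\<^sub>R integral (cbox a b) (\<lambda>y. bump c r y *\<^sub>R L y)"
      by (subst integral_add)
         (auto intro!: integrable_continuous continuous_intros simp: integral_bump_scaleR simp del: scaleR_scaleR)
    finally show "bump_average a b c r h (\<lambda>z. u + L z) \<theta> = u + (1 - h) *\<^sub>R L \<theta> + h *\<^sub>R w"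
      using mass_pos by (simp add: bump_average_def w_def scaleR_add_right)
  qed
  moreover have "((\<lambda>\<theta>. u + (1 - h) *\<^sub>R L \<theta> + h *\<^sub>R w) has_derivative (\<lambda>v. (1 - h) *\<^sub>R L v)) (at \<theta> within cbox a b)"
    by (auto intro!: derivative_eq_intros bounded_linear.has_derivative[OF L])
  moreover have "(bump_average a b c r h (\<lambda>z. u + L z) has_derivative bump_average_deriv a b c r h (\<lambda>z. u + L z) \<theta>)
      (at \<theta> within cbox a b)"
    by (rule has_derivative_bump_average[OF _ h \<theta>]) (intro continuous_intros)
  ultimately have "bump_average_deriv a b c r h (\<lambda>z. u + L z) \<theta> = (\<lambda>v. (1 - h) *\<^sub>R L v)"
    using frechet_derivative_unique_within_closed_interval[of a b \<theta>] box_ne \<theta> by (auto simp: box_ne_empty)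
  then show ?thesis by simp
qed

text \<open>
  Differentiability at the single point \<open>\<theta>\<close> is enough: subtract the first-order Taylor expansion of \<open>F\<close>
  at \<open>\<theta>\<close>. The affine part contributes \<open>(1 - h) F' v\<close>, and the remainder is \<open>o(h)\<close> at the averaged
  points, which beats the factor \<open>1 / h\<close> from differentiating the kernel.
\<close>

lemma tendsto_bump_average_deriv:
  fixes F :: "'a \<Rightarrow> 'b::euclidean_space"
  assumes F: "continuous_on (cbox a b) F" and \<theta>: "\<theta> \<in> cbox a b"
    and D: "(F has_derivative F') (at \<theta> within cbox a b)"
  shows "((\<lambda>h. bump_average_deriv a b c r h F \<theta> v) \<longlongrightarrow> F' v) (at_right 0)"
proof (rule tendstoI)
  fix e :: real assume e: "e > 0"
  have L: "bounded_linear F'" using D by (rule has_derivative_bounded_linear)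
  obtain B where B: "B > 0" "\<And>y. y \<in> cbox a b \<Longrightarrow> norm (y - \<theta>) \<le> B"
    using bounded_pos[of "(\<lambda>y. y - \<theta>) ` cbox a b"] bounded_minus_comp by (force simp: bounded_translation_minus)
  define M where "M = integral (cbox a b) (\<lambda>y. \<bar>bump_deriv c r y v\<bar>) * B / mass"
  have M: "0 \<le> M" unfolding M_def using B mass_pos
    by (intro divide_nonneg_pos mult_nonneg_nonneg integral_nonneg integrable_continuous continuous_intros) auto
  define e' where "e' = e / (2 * (M + 1))"
  have e': "e' > 0" using e M by (simp add: e'_def)
  obtain d where d: "d > 0" "\<And>z. z \<in> cbox a b \<Longrightarrow> norm (z - \<theta>) < d \<Longrightarrow> norm (F z - F \<theta> - F' (z - \<theta>)) \<le> e' * norm (z - \<theta>)"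
    using D e' unfolding has_derivative_within_alt by blast
  \<comment> \<open>\<open>d'\<close> controls the term \<open>h F' v\<close> left over from the affine part.\<close>
  define d' where "d' = e / (2 * (norm (F' v) + 1))"
  have d': "d' > 0" "d' * norm (F' v) < e / 2"
    using e by (auto simp: d'_def field_simps add_pos_nonneg)
  have "\<forall>\<^sub>F h in at_right 0. h \<in> {0<..<min (min (d / B) d') 1}"
    using d d' B by (intro eventually_at_right_real) auto
  then show "\<forall>\<^sub>F h in at_right 0. dist (bump_average_deriv a b c r h F \<theta> v) (F' v) < e"
  proof eventually_elim
    case (elim h)
    let ?G = "\<lambda>z. (F \<theta> - F' \<theta>) + F' z"
    have cG: "continuous_on (cbox a b) ?G" by (intro continuous_intros linear_continuous_on[OF L])
    have small: "norm (F ((1 - h) *\<^sub>R \<theta> + h *\<^sub>R y) - ?G ((1 - h) *\<^sub>R \<theta> + h *\<^sub>R y)) \<le> e' * (h * B)"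
      if y: "y \<in> cbox a b" for y
    proof -
      let ?z = "(1 - h) *\<^sub>R \<theta> + h *\<^sub>R y"
      have eq: "?z - \<theta> = h *\<^sub>R (y - \<theta>)" by (simp add: algebra_simps)
      have hB: "norm (?z - \<theta>) \<le> h * B" using B(2)[OF y] elim by (simp add: eq mult_left_mono)
      also have "\<dots> < d" using elim B by (simp add: field_simps)
      finally have "norm (F ?z - F \<theta> - F' (?z - \<theta>)) \<le> e' * norm (?z - \<theta>)"
        using d(2) shrink_mem_cbox[OF \<theta> y] elim by simp
      also have "\<dots> \<le> e' * (h * B)" using hB e' by (intro mult_left_mono) auto
      finally show ?thesis by (simp add: linear_simps[OF L] algebra_simps)
    qed
    have "norm (bump_average_deriv a b c r h (\<lambda>z. F z - ?G z) \<theta> v)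
        \<le> ((1 - h) / h / mass) * integral (cbox a b) (\<lambda>y. \<bar>bump_deriv c r y v\<bar> * (e' * (h * B)))"
    proof -
      have "norm (integral (cbox a b) (\<lambda>y. bump_deriv c r y v *\<^sub>R
                (F ((1 - h) *\<^sub>R \<theta> + h *\<^sub>R y) - ?G ((1 - h) *\<^sub>R \<theta> + h *\<^sub>R y))))
          \<le> integral (cbox a b) (\<lambda>y. \<bar>bump_deriv c r y v\<bar> * (e' * (h * B)))"
      proof (rule integral_norm_bound_integral)
        show "(\<lambda>y. bump_deriv c r y v *\<^sub>R (F ((1 - h) *\<^sub>R \<theta> + h *\<^sub>R y) - ?G ((1 - h) *\<^sub>R \<theta> + h *\<^sub>R y))) integrable_on cbox a b"
          using elim by (intro kernel_shift_integrable[where F = "\<lambda>z. F z - ?G z"] continuous_intros F \<theta> cG) auto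
        show "(\<lambda>y. \<bar>bump_deriv c r y v\<bar> * (e' * (h * B))) integrable_on cbox a b"
          by (intro integrable_continuous continuous_intros)
      qed (use small in \<open>auto intro!: mult_left_mono\<close>)
      then have "(1 - h) / h / mass * norm (integral (cbox a b) (\<lambda>y. bump_deriv c r y v *\<^sub>R
                (F ((1 - h) *\<^sub>R \<theta> + h *\<^sub>R y) - ?G ((1 - h) *\<^sub>R \<theta> + h *\<^sub>R y))))
          \<le> (1 - h) / h / mass * integral (cbox a b) (\<lambda>y. \<bar>bump_deriv c r y v\<bar> * (e' * (h * B)))"
        by (rule mult_left_mono) (use elim mass_pos in simp)
      moreover have "\<bar>- ((1 - h) / h) / mass\<bar> = (1 - h) / h / mass"
        using elim mass_pos by (simp add: abs_divide)
      ultimately show ?thesis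
        unfolding bump_average_deriv_def norm_scaleR by (simp only:)
    qed
    also have "\<dots> = (1 - h) * (e' * M)"
      using elim by (simp add: M_def)
    also have "\<dots> \<le> 1 * (e' * M)" using elim e' M by (intro mult_right_mono) auto
    also have "\<dots> \<le> e' * (M + 1)" using e' by (simp add: distrib_left)
    also have "\<dots> = e / 2" using M by (simp add: e'_def field_simps)
    finally have 1: "norm (bump_average_deriv a b c r h (\<lambda>z. F z - ?G z) \<theta> v) \<le> e / 2" .
    have "bump_average_deriv a b c r h (\<lambda>z. F z - ?G z) \<theta> v
        = bump_average_deriv a b c r h F \<theta> v - (1 - h) *\<^sub>R F' v"
      using elim by (subst bump_average_diff(2)[OF F cG]) (auto simp: bump_average_deriv_affine[OF L] \<theta>)
    then have "bump_average_deriv a b c r h F \<theta> v - F' v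
        = bump_average_deriv a b c r h (\<lambda>z. F z - ?G z) \<theta> v - h *\<^sub>R F' v"
      by (simp add: algebra_simps)
    also have "norm \<dots> \<le> e / 2 + norm (h *\<^sub>R F' v)"
      by (rule order_trans[OF norm_triangle_ineq4]) (use 1 in simp)
    also have "norm (h *\<^sub>R F' v) \<le> d' * norm (F' v)" using elim by (simp add: mult_right_mono)
    finally show ?case using d'(2) by (simp add: dist_norm)
  qed
qed

text \<open>
  One-sided bounds on a directional derivative survive averaging without any integrability of the
  derivative: \<open>l (F' z v) \<le> C\<close> bounds the increments of \<open>l \<circ> F\<close> in direction \<open>v\<close>, hence those of the
  average, and hence its derivative at interior points. Continuity extends the bound to the boundary,
  where neither \<open>v\<close> nor \<open>- v\<close> need point into the box. The average contracts increments by
  \<open>1 - h\<close>, so the bound obtained is \<open>(1 - h) C\<close>, at most \<open>C\<close> because \<open>0 \<le> C\<close>.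
\<close>

lemma bounded_linear_bump_average_deriv_le:
  fixes F :: "'a \<Rightarrow> 'b::euclidean_space"
  assumes D: "\<And>z. z \<in> cbox a b \<Longrightarrow> (F has_derivative F' z) (at z within cbox a b)"
    and h: "0 < h" "h \<le> 1" and \<theta>: "\<theta> \<in> cbox a b"
    and l: "bounded_linear l" and le: "\<And>z. z \<in> cbox a b \<Longrightarrow> (l (F' z v) :: real) \<le> C" and C: "0 \<le> C"
  shows "l (bump_average_deriv a b c r h F \<theta> v) \<le> C"
proof -
  have F: "continuous_on (cbox a b) F"
    using D by (meson has_derivative_continuous continuous_on_eq_continuous_within)
  have incr: "l (F (z + t *\<^sub>R v)) - l (F z) \<le> t * C"
    if z: "z \<in> cbox a b" "z + t *\<^sub>R v \<in> cbox a b" and t: "0 \<le> t" for z t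
  proof -
    have mem: "z + s *\<^sub>R v \<in> cbox a b" if "0 \<le> s" "s \<le> t" for s
    proof (cases "t = 0")
      case False
      then have "z + s *\<^sub>R v = (1 - s/t) *\<^sub>R z + (s/t) *\<^sub>R (z + t *\<^sub>R v)" by (simp add: algebra_simps)
      moreover have "0 \<le> s/t" "s/t \<le> 1" using that t by (auto simp: divide_le_eq_1)
      ultimately show ?thesis using shrink_mem_cbox[OF z] by simp
    qed (use that z in auto)
    have "\<exists>s\<in>{0..t}. l (F (z + t *\<^sub>R v)) - l (F (z + 0 *\<^sub>R v)) = l (F' (z + s *\<^sub>R v) ((t - 0) *\<^sub>R v))"
    proof (rule mvt_very_simple[OF t])
      fix s assume s: "0 \<le> s" "s \<le> t"
      have "((\<lambda>s. F (z + s *\<^sub>R v)) has_derivative (\<lambda>k. F' (z + s *\<^sub>R v) (k *\<^sub>R v))) (at s within {0..t})"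
      proof (rule has_derivative_in_compose2[where t = "cbox a b" and g = F and f' = "\<lambda>k. k *\<^sub>R v"])
        show "((\<lambda>s. z + s *\<^sub>R v) has_derivative (\<lambda>k. k *\<^sub>R v)) (at s within {0..t})"
          by (auto intro!: derivative_eq_intros)
      qed (use D mem s in auto)
      then show "((\<lambda>s. l (F (z + s *\<^sub>R v))) has_derivative (\<lambda>k. l (F' (z + s *\<^sub>R v) (k *\<^sub>R v)))) (at s within {0..t})"
        by (rule bounded_linear.has_derivative[OF l])
    qed
    then obtain s where s: "0 \<le> s" "s \<le> t" "l (F (z + t *\<^sub>R v)) - l (F z) = l (F' (z + s *\<^sub>R v) (t *\<^sub>R v))"
      by auto
    have "F' (z + s *\<^sub>R v) (t *\<^sub>R v) = t *\<^sub>R F' (z + s *\<^sub>R v) v"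
      by (rule linear_simps(5)[OF has_derivative_bounded_linear[OF D[OF mem[OF s(1,2)]]]])
    then show ?thesis using s(3) le[OF mem[OF s(1,2)]] t by (simp add: linear_simps[OF l] mult_left_mono)
  qed
  have avg_incr: "l (bump_average a b c r h F (\<theta> + t *\<^sub>R v)) - l (bump_average a b c r h F \<theta>) \<le> t * C"
    if \<theta>: "\<theta> \<in> cbox a b" "\<theta> + t *\<^sub>R v \<in> cbox a b" and t: "0 \<le> t" for \<theta> t
  proof -
    let ?A = "\<lambda>\<theta> y. (1 - h) *\<^sub>R \<theta> + h *\<^sub>R y"
    have h0: "0 \<le> h" using h by simp
    note int = kernel_shift_integrable[OF F h0 h(2) _ continuous_on_bump[OF continuous_on_id]]
    have l_avg: "l (bump_average a b c r h F \<theta>) = (1 / mass) * integral (cbox a b) (\<lambda>y. l (bump c r y *\<^sub>R F (?A \<theta> y)))"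
      and l_int: "(\<lambda>y. l (bump c r y *\<^sub>R F (?A \<theta> y))) integrable_on cbox a b"
      if "\<theta> \<in> cbox a b" for \<theta>
      using integral_linear[OF int[OF that] l] integrable_linear[OF int[OF that] l]
      by (simp_all add: bump_average_def linear_simps[OF l] o_def)
    have "integral (cbox a b) (\<lambda>y. l (bump c r y *\<^sub>R F (?A (\<theta> + t *\<^sub>R v) y)))
        - integral (cbox a b) (\<lambda>y. l (bump c r y *\<^sub>R F (?A \<theta> y)))
        = integral (cbox a b) (\<lambda>y. l (bump c r y *\<^sub>R F (?A (\<theta> + t *\<^sub>R v) y)) - l (bump c r y *\<^sub>R F (?A \<theta> y)))"
      by (rule integral_diff[symmetric]) (use l_int \<theta> in auto)
    also have "\<dots> \<le> integral (cbox a b) (\<lambda>y. bump c r y * (t * C))"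
    proof (rule integral_le)
      show "(\<lambda>y. l (bump c r y *\<^sub>R F (?A (\<theta> + t *\<^sub>R v) y)) - l (bump c r y *\<^sub>R F (?A \<theta> y))) integrable_on cbox a b"
        by (intro integrable_diff l_int \<theta>)
      show "(\<lambda>y. bump c r y * (t * C)) integrable_on cbox a b"
        by (intro integrable_continuous continuous_intros)
      fix y assume y: "y \<in> cbox a b"
      have eq: "?A (\<theta> + t *\<^sub>R v) y = ?A \<theta> y + ((1 - h) * t) *\<^sub>R v" by (simp add: algebra_simps)
      have "l (F (?A (\<theta> + t *\<^sub>R v) y)) - l (F (?A \<theta> y)) \<le> ((1 - h) * t) * C"
        unfolding eq
        by (rule incr) (use h t \<theta> y in \<open>auto simp: eq[symmetric] intro!: shrink_mem_cbox\<close>)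
      also have "\<dots> \<le> t * C" using h t C by (auto intro!: mult_right_mono mult_left_le_one_le)
      finally have "bump c r y * (l (F (?A (\<theta> + t *\<^sub>R v) y)) - l (F (?A \<theta> y))) \<le> bump c r y * (t * C)"
        by (rule mult_left_mono) (rule bump_nonneg)
      then show "l (bump c r y *\<^sub>R F (?A (\<theta> + t *\<^sub>R v) y)) - l (bump c r y *\<^sub>R F (?A \<theta> y)) \<le> bump c r y * (t * C)"
        by (simp add: linear_simps[OF l] right_diff_distrib)
    qed
    also have "\<dots> = mass * (t * C)" by simp
    finally show ?thesis
      using mass_pos by (simp add: l_avg \<theta> diff_divide_distrib[symmetric] pos_divide_le_eq mult.commute)
  qed
  have interior: "l (bump_average_deriv a b c r h F \<theta> v) \<le> C" if "\<theta> \<in> box a b" for \<theta>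
  proof (rule ccontr)
    assume gt: "\<not> ?thesis"
    have \<theta>: "\<theta> \<in> cbox a b" using that box_subset_cbox by auto
    have "at \<theta> within cbox a b = at \<theta>"
      by (rule at_within_interior) (use that in \<open>simp add: interior_cbox\<close>)
    with has_derivative_bump_average[OF F h \<theta>]
    have der: "(bump_average a b c r h F has_derivative bump_average_deriv a b c r h F \<theta>) (at \<theta>)" by simp
    have "((\<lambda>t. bump_average a b c r h F (\<theta> + t *\<^sub>R v)) has_derivative (\<lambda>k. bump_average_deriv a b c r h F \<theta> (k *\<^sub>R v))) (at 0)"
    proof (rule has_derivative_compose[of "\<lambda>t. \<theta> + t *\<^sub>R v"])
      show "((\<lambda>t. \<theta> + t *\<^sub>R v) has_derivative (\<lambda>k. k *\<^sub>R v)) (at 0)"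
        by (auto intro!: derivative_eq_intros)
    qed (use der in simp)
    from bounded_linear.has_derivative[OF l this]
    have "((\<lambda>t. l (bump_average a b c r h F (\<theta> + t *\<^sub>R v))) has_real_derivative l (bump_average_deriv a b c r h F \<theta> v)) (at 0)"
      unfolding has_field_derivative_def
      by (rule has_derivative_eq_rhs)
         (simp add: fun_eq_iff linear_simps[OF has_derivative_bounded_linear[OF der]] linear_simps[OF l])
    then have "((\<lambda>t. l (bump_average a b c r h F (\<theta> + t *\<^sub>R v)) - t * C) has_real_derivative
        l (bump_average_deriv a b c r h F \<theta> v) - C) (at 0)"
      by (auto intro!: derivative_eq_intros)
    from DERIV_pos_inc_right[OF this] gt obtain d where d: "d > 0"
      "\<And>k. 0 < k \<Longrightarrow> k < d \<Longrightarrow> l (bump_average a b c r h F \<theta>) < l (bump_average a b c r h F (\<theta> + k *\<^sub>R v)) - k * C"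
      by auto
    have "((\<lambda>t. \<theta> + t *\<^sub>R v) \<longlongrightarrow> \<theta> + 0 *\<^sub>R v) (at_right 0)" by (intro tendsto_intros)
    then have "\<forall>\<^sub>F t in at_right 0. \<theta> + t *\<^sub>R v \<in> box a b"
      by (rule topological_tendstoD) (use that in auto)
    moreover have "\<forall>\<^sub>F t in at_right 0. t \<in> {0<..<d}"
      by (rule eventually_at_right_real[OF d(1)])
    ultimately have "\<forall>\<^sub>F t in at_right (0::real). False"
    proof eventually_elim
      case (elim t)
      then have "\<theta> + t *\<^sub>R v \<in> cbox a b" using box_subset_cbox by auto
      with avg_incr[OF \<theta> this] d(2)[of t] elim show ?case by simp
    qed
    then show False by simp
  qed
  have cl: "closure (box a b) = cbox a b" using box_ne by (simp add: closure_box)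
  show ?thesis
  proof (rule continuous_le_on_closure[where S = "box a b" and f = "\<lambda>\<theta>. l (bump_average_deriv a b c r h F \<theta> v)"])
    show "continuous_on (closure (box a b)) (\<lambda>\<theta>. l (bump_average_deriv a b c r h F \<theta> v))"
      unfolding cl
      by (rule bounded_linear.continuous_on[OF l continuous_on_bump_average_deriv[OF F h]])
  qed (use \<theta> cl interior in auto)
qed

end

section \<open>Partial derivatives on a box\<close>

text \<open>
  Coordinates in which the box is degenerate do not contribute to \<open>box_deriv\<close>; this projection removes
  them from a direction.
\<close>

definition active_part :: "real ^ 'N \<Rightarrow> real ^ 'N \<Rightarrow> real ^ 'N \<Rightarrow> real ^ 'N" where
  "active_part l u v = (\<chi> i. if l $ i < u $ i then v $ i else 0)"

lemma bounded_linear_active_part: "bounded_linear (active_part l u)"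
  by (auto intro!: linear_conv_bounded_linear[THEN iffD1] linearI simp: active_part_def vec_eq_iff)

lemma active_part_idem: "active_part l u (active_part l u v) = active_part l u v"
  by (simp add: active_part_def vec_eq_iff)

lemma box_partial_eq:
  assumes F: "(F has_derivative F') (at \<theta> within cbox l u)" and \<theta>: "\<theta> \<in> cbox l u"
  shows "box_partial l u F i \<theta> = F' (active_part l u (axis i 1))"
proof (cases "l $ i < u $ i")
  case True
  define g where "g s = (\<chi> j. if j = i then s else \<theta> $ j)" for s
  have g_eq: "g s = \<theta> + (s - \<theta> $ i) *\<^sub>R axis i 1" for s
    by (simp add: g_def vec_eq_iff axis_def)
  have "(g has_derivative (\<lambda>k. k *\<^sub>R axis i 1)) (at (\<theta> $ i) within {l $ i .. u $ i})"
    unfolding g_eq[abs_def] by (auto intro!: derivative_eq_intros)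
  moreover have "(F has_derivative F') (at (g (\<theta> $ i)) within g ` {l $ i .. u $ i})"
  proof (rule has_derivative_subset)
    show "g ` {l $ i .. u $ i} \<subseteq> cbox l u" using \<theta> by (auto simp: g_def mem_box_cart)
    show "(F has_derivative F') (at (g (\<theta> $ i)) within cbox l u)" using F by (simp add: g_eq)
  qed
  ultimately have "((\<lambda>s. F (g s)) has_derivative (\<lambda>k. F' (k *\<^sub>R axis i 1))) (at (\<theta> $ i) within {l $ i .. u $ i})"
    by (rule has_derivative_in_compose)
  then have "((\<lambda>s. F (g s)) has_vector_derivative F' (axis i 1)) (at (\<theta> $ i) within {l $ i .. u $ i})"
    unfolding has_vector_derivative_def
    by (simp add: linear_simps(5)[OF has_derivative_bounded_linear[OF F]])
  then have "vector_derivative (\<lambda>s. F (g s)) (at (\<theta> $ i) within {l $ i .. u $ i}) = F' (axis i 1)"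
    using True vector_derivative_within_cbox[of "l $ i" "u $ i" "\<theta> $ i"] \<theta> by (simp add: mem_box_cart)
  moreover have "active_part l u (axis i 1) = axis i 1"
    using True by (simp add: active_part_def vec_eq_iff axis_def)
  ultimately show ?thesis using True by (simp add: box_partial_def g_def)
next
  case False
  then have "active_part l u (axis i 1) = 0"
    by (simp add: active_part_def vec_eq_iff axis_def)
  then show ?thesis using False
    by (simp add: box_partial_def linear_simps(3)[OF has_derivative_bounded_linear[OF F]])
qed

lemma box_deriv_eq:
  assumes F: "(F has_derivative F') (at \<theta> within cbox l u)" and \<theta>: "\<theta> \<in> cbox l u"
  shows "box_deriv l u F \<theta> \<mu> = F' (active_part l u \<mu>)"
proof -
  have lin: "bounded_linear (\<lambda>v. F' (active_part l u v))"
    by (rule bounded_linear_compose[OF has_derivative_bounded_linear[OF F] bounded_linear_active_part])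
  have "\<mu> = (\<Sum>i\<in>UNIV. \<mu> $ i *\<^sub>R axis i 1)"
    using basis_expansion[of \<mu>] by (simp add: scalar_mult_eq_scaleR)
  then have "F' (active_part l u \<mu>) = F' (active_part l u (\<Sum>i\<in>UNIV. \<mu> $ i *\<^sub>R axis i 1))" by simp
  also have "\<dots> = (\<Sum>i\<in>UNIV. \<mu> $ i *\<^sub>R F' (active_part l u (axis i 1)))"
    by (simp add: linear_sum[OF bounded_linear.linear[OF lin]] linear_simps(5)[OF lin])
  finally show ?thesis by (simp add: box_deriv_def box_partial_eq[OF F \<theta>])
qed

lemma differentiable_on_has_derivative:
  assumes "F differentiable_on S" "\<theta> \<in> S"
  obtains F' where "(F has_derivative F') (at \<theta> within S)"
  using assms by (auto simp: differentiable_on_def differentiable_def)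

lemma box_deriv_bounded_linear:
  assumes F: "F differentiable_on cbox l u" and \<theta>: "\<theta> \<in> cbox l u" and f: "bounded_linear f"
    and G: "\<And>z. z \<in> cbox l u \<Longrightarrow> G z = f (F z)"
  shows "box_deriv l u G \<theta> \<mu> = f (box_deriv l u F \<theta> \<mu>)"
proof -
  obtain F' where F': "(F has_derivative F') (at \<theta> within cbox l u)"
    using differentiable_on_has_derivative[OF F \<theta>] .
  have "(G has_derivative (\<lambda>v. f (F' v))) (at \<theta> within cbox l u)"
    by (rule has_derivative_transform[OF \<theta> G bounded_linear.has_derivative[OF f F']])
  from box_deriv_eq[OF this \<theta>] box_deriv_eq[OF F' \<theta>] show ?thesis by simp
qed

lemma box_deriv_add_scaled:
  assumes F: "F differentiable_on cbox l u" and G: "G differentiable_on cbox l u" and \<theta>: "\<theta> \<in> cbox l u"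
  shows "box_partial l u (\<lambda>z. s *\<^sub>R F z + t *\<^sub>R G z) i \<theta> = s *\<^sub>R box_partial l u F i \<theta> + t *\<^sub>R box_partial l u G i \<theta>"
    and "box_deriv l u (\<lambda>z. s *\<^sub>R F z + t *\<^sub>R G z) \<theta> \<mu> = s *\<^sub>R box_deriv l u F \<theta> \<mu> + t *\<^sub>R box_deriv l u G \<theta> \<mu>"
proof -
  obtain F' where F': "(F has_derivative F') (at \<theta> within cbox l u)"
    using differentiable_on_has_derivative[OF F \<theta>] .
  obtain G' where G': "(G has_derivative G') (at \<theta> within cbox l u)"
    using differentiable_on_has_derivative[OF G \<theta>] .
  have "((\<lambda>z. s *\<^sub>R F z + t *\<^sub>R G z) has_derivative (\<lambda>v. s *\<^sub>R F' v + t *\<^sub>R G' v)) (at \<theta> within cbox l u)"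
    by (intro has_derivative_add has_derivative_scaleR_right F' G')
  then show "box_partial l u (\<lambda>z. s *\<^sub>R F z + t *\<^sub>R G z) i \<theta> = s *\<^sub>R box_partial l u F i \<theta> + t *\<^sub>R box_partial l u G i \<theta>"
    and "box_deriv l u (\<lambda>z. s *\<^sub>R F z + t *\<^sub>R G z) \<theta> \<mu> = s *\<^sub>R box_deriv l u F \<theta> \<mu> + t *\<^sub>R box_deriv l u G \<theta> \<mu>"
    using F' G' \<theta> by (simp_all add: box_partial_eq box_deriv_eq)
qed

text \<open>
  A degenerate box has measure zero, so averages over it carry no information. Each degenerate side is
  therefore widened to length 1, and \<open>F\<close> is extended to be constant in these coordinates by composing
  with the projection \<open>\<pi>\<close>. This changes neither \<open>F\<close> nor \<open>box_deriv\<close> on the original box.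
\<close>

lemma smooth_approximation_on_box:
  fixes F :: "real ^ 'N \<Rightarrow> 'b::euclidean_space"
  assumes lu: "\<And>i. l $ i \<le> u $ i" and F: "F differentiable_on cbox l u"
  obtains Q :: "nat \<Rightarrow> real ^ 'N \<Rightarrow> 'b" where
    "\<And>n. Q n differentiable_on cbox l u"
    "\<And>n i. continuous_on (cbox l u) (box_partial l u (Q n) i)"
    "\<And>\<theta>. \<theta> \<in> cbox l u \<Longrightarrow> (\<lambda>n. Q n \<theta>) \<longlonglongrightarrow> F \<theta>"
    "\<And>\<theta> \<mu>. \<theta> \<in> cbox l u \<Longrightarrow> (\<lambda>n. box_deriv l u (Q n) \<theta> \<mu>) \<longlonglongrightarrow> box_deriv l u F \<theta> \<mu>"
    "\<And>n \<theta> f m. \<theta> \<in> cbox l u \<Longrightarrow> bounded_linear f \<Longrightarrow> (\<And>z. z \<in> cbox l u \<Longrightarrow> m \<le> (f (F z) :: real)) \<Longrightarrow> m \<le> f (Q n \<theta>)"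
    "\<And>n \<theta> \<mu> f C. \<theta> \<in> cbox l u \<Longrightarrow> bounded_linear f \<Longrightarrow> 0 \<le> C \<Longrightarrow>
       (\<And>z. z \<in> cbox l u \<Longrightarrow> (f (box_deriv l u F z \<mu>) :: real) \<le> C) \<Longrightarrow> f (box_deriv l u (Q n) \<theta> \<mu>) \<le> C"
proof -
  define b where "b = (\<chi> i. if l $ i < u $ i then u $ i else l $ i + 1)"
  define \<pi> where "\<pi> \<theta> = active_part l u \<theta> + (l - active_part l u l)" for \<theta>
  have \<pi>_nth: "\<pi> \<theta> $ i = (if l $ i < u $ i then \<theta> $ i else l $ i)" for \<theta> i
    by (simp add: \<pi>_def active_part_def)
  have \<pi>_mem: "\<pi> \<theta> \<in> cbox l u" if "\<theta> \<in> cbox l b" for \<theta>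
    using that lu unfolding mem_box_cart \<pi>_nth b_def by (auto split: if_splits)
  have sub: "cbox l u \<subseteq> cbox l b"
    using lu by (auto simp: mem_box_cart b_def; smt (verit))
  have \<pi>_id: "\<pi> \<theta> = \<theta>" if "\<theta> \<in> cbox l u" for \<theta>
    using that by (auto simp: vec_eq_iff \<pi>_nth mem_box_cart not_less intro: antisym order_trans)
  have "box l b \<noteq> {}" by (simp add: interval_ne_empty_cart b_def)
  then obtain c where "c \<in> box l b" by blast
  with open_box[of l b] obtain r where r: "0 < r" "cball c r \<subseteq> box l b"
    by (auto simp: open_contains_cball)
  interpret box_mollifier l b c r
    using r box_subset_cbox by unfold_locales auto
  obtain F' where F': "\<And>z. z \<in> cbox l u \<Longrightarrow> (F has_derivative F' z) (at z within cbox l u)"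
    using F unfolding differentiable_on_def differentiable_def by metis
  define G where "G = (\<lambda>z. F (\<pi> z))"
  define G' where "G' z = (\<lambda>v. F' (\<pi> z) (active_part l u v))" for z
  have d\<pi>: "(\<pi> has_derivative active_part l u) (at z within S)" for z S
    unfolding \<pi>_def[abs_def]
    by (intro has_derivative_add_const bounded_linear_imp_has_derivative bounded_linear_active_part)
  have G': "(G has_derivative G' z) (at z within cbox l b)" if "z \<in> cbox l b" for z
    unfolding G_def G'_def
    by (rule has_derivative_in_compose2[where t = "cbox l u" and g = F]) (use F' \<pi>_mem that d\<pi> in auto)
  have G: "continuous_on (cbox l b) G"
    using G' by (meson has_derivative_continuous continuous_on_eq_continuous_within)
  define h where "h n = 1 / real (n + 2)" for n
  have h: "0 < h n" "h n \<le> 1" for n by (auto simp: h_def)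
  have h_lim: "filterlim h (at_right 0) sequentially"
    unfolding filterlim_at
  proof
    show "h \<longlonglongrightarrow> 0"
      unfolding h_def[abs_def] by (rule LIMSEQ_ignore_initial_segment[OF lim_1_over_n])
  qed (auto simp: h_def intro!: always_eventually)
  define Q where "Q n = bump_average l b c r (h n) G" for n
  define Q' where "Q' n = bump_average_deriv l b c r (h n) G" for n
  have Q': "(Q n has_derivative Q' n \<theta>) (at \<theta> within cbox l u)" if "\<theta> \<in> cbox l u" for n \<theta>
    unfolding Q_def Q'_def
    by (rule has_derivative_subset[OF has_derivative_bump_average[OF G h] sub]) (use that sub in auto)
  have F_box: "box_deriv l u F z \<mu> = F' z (active_part l u \<mu>)" if "z \<in> cbox l u" for z \<mu>
    by (rule box_deriv_eq[OF F'[OF that] that])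
  have Q_box: "box_deriv l u (Q n) z \<mu> = Q' n z (active_part l u \<mu>)" if "z \<in> cbox l u" for n z \<mu>
    by (rule box_deriv_eq[OF Q'[OF that] that])
  show thesis
  proof
    show "Q n differentiable_on cbox l u" for n
      using Q' unfolding differentiable_on_def differentiable_def by blast
    show "continuous_on (cbox l u) (box_partial l u (Q n) i)" for n i
    proof (rule continuous_on_eq)
      show "continuous_on (cbox l u) (\<lambda>\<theta>. Q' n \<theta> (active_part l u (axis i 1)))"
        unfolding Q'_def by (rule continuous_on_subset[OF continuous_on_bump_average_deriv[OF G h] sub])
    qed (simp add: box_partial_eq[OF Q'])
    fix \<theta> assume \<theta>: "\<theta> \<in> cbox l u"
    then have \<theta>b: "\<theta> \<in> cbox l b" using sub by blast
    show "(\<lambda>n. Q n \<theta>) \<longlonglongrightarrow> F \<theta>"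
      using filterlim_compose[OF tendsto_bump_average[OF G \<theta>b] h_lim] by (simp add: Q_def G_def \<pi>_id \<theta>)
    show "(\<lambda>n. box_deriv l u (Q n) \<theta> \<mu>) \<longlonglongrightarrow> box_deriv l u F \<theta> \<mu>" for \<mu>
      using filterlim_compose[OF tendsto_bump_average_deriv[OF G \<theta>b G'[OF \<theta>b]] h_lim, of "active_part l u \<mu>"]
      by (simp add: Q_box F_box \<theta> Q'_def G'_def \<pi>_id active_part_idem)
    fix n and f :: "'b \<Rightarrow> real" assume f: "bounded_linear f"
    show "m \<le> f (Q n \<theta>)" if "\<And>z. z \<in> cbox l u \<Longrightarrow> m \<le> f (F z)" for m
      unfolding Q_def
      by (rule bounded_linear_bump_average_ge[OF G _ _ \<theta>b f]) (use h[of n] that \<pi>_mem in \<open>auto simp: G_def\<close>)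
    show "f (box_deriv l u (Q n) \<theta> \<mu>) \<le> C"
      if "0 \<le> C" "\<And>z. z \<in> cbox l u \<Longrightarrow> f (box_deriv l u F z \<mu>) \<le> C" for C \<mu>
      unfolding Q_box[OF \<theta>] Q'_def
      by (rule bounded_linear_bump_average_deriv_le[OF G' h \<theta>b f])
         (use that \<pi>_mem F_box in \<open>auto simp: G'_def active_part_idem\<close>)
  qed
qed

section \<open>Quadratic forms and the Lyapunov inequality\<close>

lemma transpose_add: "transpose (M + N) = transpose M + transpose (N :: real ^ 'n ^ 'm)"
  by (simp add: transpose_def vec_eq_iff)

lemma transpose_uminus: "transpose (- M) = - transpose (M :: real ^ 'n ^ 'm)"
  by (simp add: transpose_def vec_eq_iff)

lemma matrix_vector_mult_uminus: "(- M) *v x = - (M *v x)" for M :: "real ^ 'n ^ 'm"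
  by (simp add: matrix_vector_mult_def vec_eq_iff sum_negf)

lemma bounded_linear_transpose: "bounded_linear (transpose :: real ^ 'n ^ 'm \<Rightarrow> _)"
  by (auto intro!: linear_conv_bounded_linear[THEN iffD1] linearI simp: transpose_add transpose_scalar)

lemma bounded_linear_bilinear_form: "bounded_linear (\<lambda>M :: real ^ 'n ^ 'm. x \<bullet> (M *v y))"
  by (auto intro!: linear_conv_bounded_linear[THEN iffD1] linearI
      simp: matrix_vector_mult_add_rdistrib inner_add_right scaleR_matrix_vector_assoc[symmetric])

lemma continuous_on_matrix_vector_mult [continuous_intros]:
  fixes f :: "'a::topological_space \<Rightarrow> real ^ 'n ^ 'm"
  assumes "continuous_on S f" "continuous_on S g"
  shows "continuous_on S (\<lambda>z. f z *v g z)"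
  unfolding matrix_vector_mult_def by (intro continuous_intros assms)

lemma quadratic_form_lyapunov:
  fixes D M A :: "real ^ 'n ^ 'n"
  shows "x \<bullet> ((D + transpose A ** M + M ** A) *v x) =
     x \<bullet> (D *v x) + ((A *v x) \<bullet> (M *v x) + x \<bullet> (M *v (A *v x)))"
proof -
  have "x \<bullet> (transpose A *v y) = (A *v x) \<bullet> y" for y
    using dot_lmul_matrix[of y A x] by (simp add: inner_commute)
  then show ?thesis
    by (simp add: matrix_vector_mult_add_rdistrib inner_add_right matrix_vector_mul_assoc[symmetric] del: transpose_matrix_vector)
qed

lemma Sym_mult_symmetric:
  assumes "transpose M = M"
  shows "Sym (M ** A) = transpose A ** M + M ** A"
  using assms by (simp add: Sym_def matrix_transpose_mul add.commute)

lemma quadratic_form_scaleR: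
  fixes M :: "real ^ 'n ^ 'n"
  shows "(c *\<^sub>R x) \<bullet> (M *v (c *\<^sub>R x)) = c\<^sup>2 * (x \<bullet> (M *v x))"
  by (simp add: matrix_vector_mult_scaleR power2_eq_square)

lemma quadratic_form_le_of_sphere:
  fixes M :: "real ^ 'n ^ 'n"
  assumes "\<And>x. norm x = 1 \<Longrightarrow> x \<bullet> (M *v x) \<le> c"
  shows "x \<bullet> (M *v x) \<le> c * (x \<bullet> x)"
proof (cases "x = 0")
  case False
  define y where "y = (1 / norm x) *\<^sub>R x"
  have y: "norm y = 1" "x = norm x *\<^sub>R y" using False by (simp_all add: y_def)
  have "x \<bullet> (M *v x) = (norm x)\<^sup>2 * (y \<bullet> (M *v y))"
    using quadratic_form_scaleR[of "norm x" y M] y(2) by simp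
  also have "\<dots> \<le> (norm x)\<^sup>2 * c" using assms[OF y(1)] by (intro mult_left_mono) auto
  finally show ?thesis by (simp add: dot_square_norm mult.commute)
qed simp

lemma quadratic_form_ge_of_sphere:
  fixes M :: "real ^ 'n ^ 'n"
  assumes "\<And>x. norm x = 1 \<Longrightarrow> c \<le> x \<bullet> (M *v x)"
  shows "c * (x \<bullet> x) \<le> x \<bullet> (M *v x)"
proof -
  have "x \<bullet> ((- M) *v x) \<le> (- c) * (x \<bullet> x)"
    by (rule quadratic_form_le_of_sphere) (use assms in \<open>simp add: matrix_vector_mult_uminus\<close>)
  then show ?thesis by (simp add: matrix_vector_mult_uminus)
qed

lemma loewner_le_0_iff: "X \<preceq>\<^sub>L 0 \<longleftrightarrow> transpose X = X \<and> (\<forall>x. x \<bullet> (X *v x) \<le> 0)"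
  and loewner_less_0_iff: "X \<prec>\<^sub>L 0 \<longleftrightarrow> transpose X = X \<and> (\<forall>x. x \<noteq> 0 \<longrightarrow> x \<bullet> (X *v x) < 0)"
  unfolding loewner_le_def loewner_less_def pos_semidef_def pos_def_def
  by (simp_all add: transpose_uminus matrix_vector_mult_uminus)

definition lyapunov_form ::
  "real ^ 'N \<Rightarrow> real ^ 'N \<Rightarrow> (real ^ 'N \<Rightarrow> real ^ 'n ^ 'n) \<Rightarrow> (real ^ 'N \<Rightarrow> real ^ 'n ^ 'n) \<Rightarrow>
   (real ^ 'N) \<times> (real ^ 'N) \<times> (real ^ 'n) \<Rightarrow> real" where
  "lyapunov_form l u A Q = (\<lambda>(\<theta>, \<mu>, x).
     x \<bullet> ((box_deriv l u Q \<theta> \<mu> + transpose (A \<theta>) ** Q \<theta> + Q \<theta> ** A \<theta>) *v x))"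

lemma continuous_on_lyapunov_form:
  assumes Q: "Q differentiable_on cbox l u" "\<And>i. continuous_on (cbox l u) (box_partial l u Q i)"
    and A: "continuous_on (cbox l u) A"
  shows "continuous_on (cbox l u \<times> V \<times> Z) (lyapunov_form l u A Q)"
proof -
  note [continuous_intros] = continuous_on_compose2[OF differentiable_imp_continuous_on[OF Q(1)]]
    continuous_on_compose2[OF Q(2)] continuous_on_compose2[OF A]
  show ?thesis
    unfolding lyapunov_form_def quadratic_form_lyapunov split_beta box_deriv_def
    by (intro continuous_intros) auto
qed

lemma compact_box_vertices: "compact (box_vertices l u)"
proof (rule compact_eq_bounded_closed[THEN iffD2, OF conjI])
  have "norm (\<mu> $ i) \<le> \<bar>l $ i\<bar> + \<bar>u $ i\<bar>" if "\<mu> \<in> box_vertices l u" for \<mu> i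
  proof -
    have "\<mu> $ i = l $ i \<or> \<mu> $ i = u $ i" using that by (auto simp: box_vertices_def)
    then show ?thesis by auto
  qed
  then have "norm \<mu> \<le> (\<Sum>i\<in>UNIV. \<bar>l $ i\<bar> + \<bar>u $ i\<bar>)" if "\<mu> \<in> box_vertices l u" for \<mu>
    using that by (intro order_trans[OF norm_le_l1_cart] sum_mono) auto
  then show "bounded (box_vertices l u)" by (auto simp: bounded_iff)
  have "box_vertices l u = (\<Inter>i. {\<mu>. \<mu> $ i = l $ i \<or> \<mu> $ i = u $ i})"
    by (auto simp: box_vertices_def)
  moreover have "closed {\<mu> :: real ^ _. \<mu> $ i = l $ i \<or> \<mu> $ i = u $ i}" for i
    by (intro closed_Collect_disj closed_Collect_eq continuous_intros)
  ultimately show "closed (box_vertices l u)" by auto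
qed

lemma lyapunov_form_add_scaled:
  assumes "F differentiable_on cbox l u" "G differentiable_on cbox l u" "\<theta> \<in> cbox l u"
  shows "lyapunov_form l u A (\<lambda>z. s *\<^sub>R F z + t *\<^sub>R G z) (\<theta>, \<mu>, x)
       = s * lyapunov_form l u A F (\<theta>, \<mu>, x) + t * lyapunov_form l u A G (\<theta>, \<mu>, x)"
  unfolding lyapunov_form_def split quadratic_form_lyapunov box_deriv_add_scaled[OF assms]
  by (simp add: linear_simps[OF bounded_linear_bilinear_form] algebra_simps inner_add_right matrix_vector_mult_add_rdistrib
       scaleR_matrix_vector_assoc[symmetric])

text \<open>
  The set \<open>R n\<close> below stands in for the convex hull of the mollifications \<open>Pm m\<close> with \<open>m \<ge> n\<close> by the
  properties that are needed: regularity, positivity, and obeying at each point every upper bound for the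
  Lyapunov form that all these \<open>Pm m\<close> obey. This set is visibly convex.
\<close>

lemma exists_C1_strict_lyapunov:
  fixes l u \<nu>l \<nu>u :: "real ^ 'N" and A P :: "real ^ 'N \<Rightarrow> real ^ 'n ^ 'n"
  assumes lu: "\<And>i. l $ i \<le> u $ i" and A: "continuous_on (cbox l u) A"
    and P: "P differentiable_on cbox l u"
    and pos: "\<And>\<theta>. \<theta> \<in> cbox l u \<Longrightarrow> pos_def (P \<theta>)"
    and neg: "\<And>\<theta> \<mu>. \<theta> \<in> cbox l u \<Longrightarrow> \<mu> \<in> box_vertices \<nu>l \<nu>u \<Longrightarrow>
      box_deriv l u P \<theta> \<mu> + transpose (A \<theta>) ** P \<theta> + P \<theta> ** A \<theta> \<prec>\<^sub>L 0"
  obtains Q where "Q differentiable_on cbox l u" "\<And>i. continuous_on (cbox l u) (box_partial l u Q i)"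
    "\<And>\<theta>. \<theta> \<in> cbox l u \<Longrightarrow> pos_def (Q \<theta>)"
    "\<And>b. b \<in> cbox l u \<times> box_vertices \<nu>l \<nu>u \<times> sphere 0 1 \<Longrightarrow> lyapunov_form l u A Q b < 0"
proof -
  let ?K = "cbox l u" and ?S = "sphere 0 1 :: (real ^ 'n) set" and ?L = "lyapunov_form l u A"
  let ?B = "?K \<times> box_vertices \<nu>l \<nu>u \<times> ?S"
  obtain Pm where Pm_diff: "\<And>n. Pm n differentiable_on ?K"
    and Pm_cont: "\<And>n i. continuous_on ?K (box_partial l u (Pm n) i)"
    and Pm_lim: "\<And>\<theta>. \<theta> \<in> ?K \<Longrightarrow> (\<lambda>n. Pm n \<theta>) \<longlonglongrightarrow> P \<theta>"
    and Pm_deriv_lim: "\<And>\<theta> \<mu>. \<theta> \<in> ?K \<Longrightarrow> (\<lambda>n. box_deriv l u (Pm n) \<theta> \<mu>) \<longlonglongrightarrow> box_deriv l u P \<theta> \<mu>"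
    and Pm_ge: "\<And>n \<theta> f m. \<theta> \<in> ?K \<Longrightarrow> bounded_linear f \<Longrightarrow> (\<And>z. z \<in> ?K \<Longrightarrow> m \<le> (f (P z) :: real)) \<Longrightarrow> m \<le> f (Pm n \<theta>)"
    and Pm_deriv_le: "\<And>n \<theta> \<mu> f C. \<theta> \<in> ?K \<Longrightarrow> bounded_linear f \<Longrightarrow> 0 \<le> C \<Longrightarrow>
       (\<And>z. z \<in> ?K \<Longrightarrow> (f (box_deriv l u P z \<mu>) :: real) \<le> C) \<Longrightarrow> f (box_deriv l u (Pm n) \<theta> \<mu>) \<le> C"
    using smooth_approximation_on_box[OF lu P] by blast
  have contP: "continuous_on ?K P" by (rule differentiable_imp_continuous_on[OF P])
  note [continuous_intros] = continuous_on_compose2[OF contP] continuous_on_compose2[OF A]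
  have K_ne: "?K \<noteq> {}" using lu by (simp add: interval_ne_empty_cart)
  have transposeP: "transpose (P z) = P z" if "z \<in> ?K" for z using pos[OF that] by (simp add: pos_def_def)
  have Pm_pos: "pos_def (Pm n \<theta>)" if \<theta>: "\<theta> \<in> ?K" for n \<theta>
  proof -
    have "transpose (Pm n \<theta>) $ i $ j = Pm n \<theta> $ i $ j" for i j
    proof -
      have bl: "bounded_linear (\<lambda>M :: real ^ 'n ^ 'n. M $ i' $ j' - M $ j' $ i')" for i' j'
        by (intro bounded_linear_sub bounded_linear_compose[OF bounded_linear_vec_nth bounded_linear_vec_nth])
      have "P z $ i $ j = P z $ j $ i" if "z \<in> ?K" for z i j
        using transposeP[OF that] by (metis transpose_def vec_lambda_beta)
      then have "0 \<le> Pm n \<theta> $ i' $ j' - Pm n \<theta> $ j' $ i'" for i' j'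
        by (intro Pm_ge[OF \<theta> bl]) simp
      from this[of i j] this[of j i] show ?thesis by (simp add: transpose_def)
    qed
    moreover have "0 < x \<bullet> (Pm n \<theta> *v x)" if x: "x \<noteq> 0" for x
    proof -
      have "continuous_on ?K (\<lambda>z. x \<bullet> (P z *v x))" by (intro continuous_intros) auto
      then obtain z where z: "z \<in> ?K" "\<And>y. y \<in> ?K \<Longrightarrow> x \<bullet> (P z *v x) \<le> x \<bullet> (P y *v x)"
        using continuous_attains_inf[OF compact_cbox K_ne] by metis
      have "0 < x \<bullet> (P z *v x)" using pos[OF z(1)] x by (simp add: pos_def_def)
      also have "\<dots> \<le> x \<bullet> (Pm n \<theta> *v x)" by (rule Pm_ge[OF \<theta> bounded_linear_bilinear_form z(2)])
      finally show ?thesis .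
    qed
    ultimately show ?thesis by (simp add: pos_def_def vec_eq_iff)
  qed
  \<comment> \<open>The part of the Lyapunov form without derivatives is uniformly bounded, also when \<open>P\<close> is evaluated
    at another point \<open>z\<close> than \<open>A\<close>. The negativity of the form then bounds the derivative part from above.\<close>
  define drift where "drift \<theta> x M = (A \<theta> *v x) \<bullet> (M *v x) + x \<bullet> (M *v (A \<theta> *v x))"
    for \<theta> and x :: "real ^ 'n" and M :: "real ^ 'n ^ 'n"
  have L_eq: "?L Q (\<theta>, \<mu>, x) = x \<bullet> (box_deriv l u Q \<theta> \<mu> *v x) + drift \<theta> x (Q \<theta>)" for Q \<theta> \<mu> x
    by (simp add: lyapunov_form_def quadratic_form_lyapunov drift_def)
  have bl_drift: "bounded_linear (drift \<theta> x)" for \<theta> x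
    unfolding drift_def by (intro bounded_linear_add bounded_linear_bilinear_form)
  have "continuous_on (?K \<times> ?S \<times> ?K) (\<lambda>(\<theta>, x, z). drift \<theta> x (P z))"
    unfolding drift_def split_beta by (intro continuous_intros) auto
  then have "bounded ((\<lambda>(\<theta>, x, z). drift \<theta> x (P z)) ` (?K \<times> ?S \<times> ?K))"
    by (intro compact_imp_bounded compact_continuous_image compact_Times compact_cbox compact_sphere)
  then obtain C where C: "0 < C" "\<And>\<theta> x z. \<theta> \<in> ?K \<Longrightarrow> x \<in> ?S \<Longrightarrow> z \<in> ?K \<Longrightarrow> \<bar>drift \<theta> x (P z)\<bar> \<le> C"
    unfolding bounded_pos by force
  have L_neg: "?L P b < 0" if b: "b \<in> ?B" for b
  proof -
    obtain \<theta> \<mu> x where "b = (\<theta>, \<mu>, x)" "\<theta> \<in> ?K" "\<mu> \<in> box_vertices \<nu>l \<nu>u" "norm x = 1" using b by auto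
    moreover from this have "x \<noteq> 0" by auto
    ultimately show ?thesis using neg[of \<theta> \<mu>] unfolding loewner_less_0_iff lyapunov_form_def by auto
  qed
  have Pm_L_le: "?L (Pm n) b \<le> C + C" if b: "b \<in> ?B" for n b
  proof -
    obtain \<theta> \<mu> x where b: "b = (\<theta>, \<mu>, x)" "\<theta> \<in> ?K" "\<mu> \<in> box_vertices \<nu>l \<nu>u" "x \<in> ?S" using b by auto
    have "x \<bullet> (box_deriv l u (Pm n) \<theta> \<mu> *v x) \<le> C"
    proof (rule Pm_deriv_le[OF b(2) bounded_linear_bilinear_form])
      fix z assume z: "z \<in> ?K"
      have "?L P (z, \<mu>, x) < 0" using L_neg b z by auto
      then show "x \<bullet> (box_deriv l u P z \<mu> *v x) \<le> C"
        using C(2)[OF z b(4) z] unfolding L_eq by linarith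
    qed (use C in simp)
    moreover have "- C \<le> - drift \<theta> x (Pm n \<theta>)"
      by (rule Pm_ge[OF b(2) bounded_linear_minus[OF bl_drift]])
         (use C(2)[OF b(2) b(4)] in \<open>force simp: abs_le_iff\<close>)
    ultimately show ?thesis unfolding b(1) L_eq by linarith
  qed
  have Pm_L_lim: "(\<lambda>n. ?L (Pm n) b) \<longlonglongrightarrow> ?L P b" if b: "b \<in> ?B" for b
  proof -
    obtain \<theta> \<mu> x where b: "b = (\<theta>, \<mu>, x)" "\<theta> \<in> ?K" using b by auto
    show ?thesis unfolding b(1) L_eq
      by (intro tendsto_add bounded_linear.tendsto[OF bounded_linear_bilinear_form Pm_deriv_lim[OF b(2)]]
            bounded_linear.tendsto[OF bl_drift Pm_lim[OF b(2)]])
  qed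
  define R where "R n = {Q. Q differentiable_on ?K \<and> (\<forall>i. continuous_on ?K (box_partial l u Q i)) \<and>
      (\<forall>\<theta>\<in>?K. pos_def (Q \<theta>)) \<and> (\<forall>b\<in>?B. \<forall>s. (\<forall>m\<ge>n. ?L (Pm m) b \<le> s) \<longrightarrow> ?L Q b \<le> s)}" for n :: nat
  \<comment> \<open>\<open>box_deriv\<close> is additive only on the box, so the functions are set to 0 elsewhere to make the family
    convex as a set of functions on the whole space.\<close>
  define \<Gamma> where "\<Gamma> Q = (\<lambda>b. if b \<in> ?B then ?L Q b else 0)" for Q
  have "\<exists>f\<in>\<Gamma> ` R 0. \<forall>b\<in>?B. f b < 0" if B_ne: "?B \<noteq> {}"
  proof (rule compact_convex_family_negative[where W = "\<lambda>n. \<Gamma> ` R n", OF _ B_ne])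
    show "compact ?B" by (intro compact_Times compact_cbox compact_box_vertices compact_sphere)
    show "\<Gamma> ` R n \<noteq> {}" for n
    proof -
      have "Pm n \<in> R n" using Pm_diff Pm_cont Pm_pos by (auto simp: R_def)
      then show ?thesis by blast
    qed
    show "\<Gamma> ` R (Suc n) \<subseteq> \<Gamma> ` R n" for n
      by (rule image_mono) (auto simp: R_def)
    show "(\<lambda>b. t * f b + (1 - t) * g b) \<in> \<Gamma> ` R n"
      if fg: "f \<in> \<Gamma> ` R n" "g \<in> \<Gamma> ` R n" and t: "0 \<le> t" "t \<le> 1" for n f g t
    proof -
      obtain F G where F: "F \<in> R n" "f = \<Gamma> F" and G: "G \<in> R n" "g = \<Gamma> G" using fg by blast
      define H where "H = (\<lambda>z. t *\<^sub>R F z + (1 - t) *\<^sub>R G z)"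
      have FG: "F differentiable_on ?K" "G differentiable_on ?K" using F G by (auto simp: R_def)
      have LH: "?L H b = t * ?L F b + (1 - t) * ?L G b" if "b \<in> ?B" for b
        using that lyapunov_form_add_scaled[OF FG] by (auto simp: H_def)
      have "H differentiable_on ?K" unfolding H_def using FG by (auto simp: differentiable_on_def)
      moreover have "continuous_on ?K (box_partial l u H i)" for i
      proof (rule continuous_on_eq)
        show "continuous_on ?K (\<lambda>\<theta>. t *\<^sub>R box_partial l u F i \<theta> + (1 - t) *\<^sub>R box_partial l u G i \<theta>)"
          using F G by (intro continuous_intros) (auto simp: R_def)
      qed (simp add: H_def box_deriv_add_scaled[OF FG])
      moreover have "pos_def (H \<theta>)" if "\<theta> \<in> ?K" for \<theta>
      proof -
        have p: "pos_def (F \<theta>)" "pos_def (G \<theta>)" using F G that by (auto simp: R_def)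
        have "0 < t * (x \<bullet> (F \<theta> *v x)) + (1 - t) * (x \<bullet> (G \<theta> *v x))" if "x \<noteq> 0" for x
        proof (cases "t = 0")
          case False
          then show ?thesis using p t that by (intro add_pos_nonneg mult_pos_pos mult_nonneg_nonneg) (auto simp: pos_def_def less_imp_le)
        qed (use p that in \<open>simp add: pos_def_def\<close>)
        then show ?thesis using p
          by (simp add: pos_def_def H_def linear_simps[OF bounded_linear_bilinear_form] transpose_add transpose_scalar)
      qed
      moreover have "?L H b \<le> s" if "b \<in> ?B" "\<forall>m\<ge>n. ?L (Pm m) b \<le> s" for b s
      proof -
        have "?L F b \<le> s" "?L G b \<le> s" using F G that by (auto simp: R_def)
        then have "t * ?L F b + (1 - t) * ?L G b \<le> t * s + (1 - t) * s"
          using t by (intro add_mono mult_left_mono) auto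
        then show ?thesis using LH[OF that(1)] by (simp add: algebra_simps)
      qed
      ultimately have "H \<in> R n" by (auto simp: R_def)
      moreover have "(\<lambda>b. t * f b + (1 - t) * g b) = \<Gamma> H"
        using LH by (auto simp: F G \<Gamma>_def)
      ultimately show ?thesis by blast
    qed
    show "continuous_on ?B f" if f: "f \<in> \<Gamma> ` R 0" for f
    proof -
      obtain Q where Q: "Q \<in> R 0" "f = \<Gamma> Q" using f by blast
      have "continuous_on ?B (?L Q)" by (rule continuous_on_lyapunov_form) (use Q A in \<open>auto simp: R_def\<close>)
      then show ?thesis by (rule continuous_on_eq) (simp add: Q \<Gamma>_def)
    qed
    show "f b \<le> C + C" if f: "f \<in> \<Gamma> ` R 0" and b: "b \<in> ?B" for f b
    proof -
      obtain Q where Q: "Q \<in> R 0" "f = \<Gamma> Q" using f by blast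
      have "?L Q b \<le> C + C" using Q(1) b Pm_L_le[OF b] unfolding R_def by blast
      then show ?thesis using b by (simp add: Q \<Gamma>_def)
    qed
    show "\<exists>\<delta>>0. \<exists>n. \<forall>f\<in>\<Gamma> ` R n. f b \<le> - \<delta>" if b: "b \<in> ?B" for b
    proof -
      have "\<forall>\<^sub>F n in sequentially. ?L (Pm n) b < ?L P b / 2"
        by (rule order_tendstoD(2)[OF Pm_L_lim[OF b]]) (use L_neg[OF b] in simp)
      then obtain n where n: "\<forall>m\<ge>n. ?L (Pm m) b \<le> ?L P b / 2"
        unfolding eventually_sequentially by (meson less_imp_le)
      have "f b \<le> - (- ?L P b / 2)" if "f \<in> \<Gamma> ` R n" for f
      proof -
        obtain Q where Q: "Q \<in> R n" "f = \<Gamma> Q" using \<open>f \<in> \<Gamma> ` R n\<close> by blast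
        have "?L Q b \<le> ?L P b / 2" using Q(1) b n unfolding R_def by blast
        then show ?thesis using b by (simp add: Q \<Gamma>_def)
      qed
      then show ?thesis using L_neg[OF b] by (intro exI[of _ "- ?L P b / 2"]) auto
    qed
  qed
  then obtain Q where Q: "Q \<in> R 0" "\<forall>b\<in>?B. ?L Q b < 0"
  proof (cases "?B = {}")
    case True
    have "Pm 0 \<in> R 0" using Pm_diff Pm_cont Pm_pos by (auto simp: R_def)
    with True show thesis by (intro that[of "Pm 0"]) blast+
  next
    case False
    with \<open>?B \<noteq> {} \<Longrightarrow> \<exists>f\<in>\<Gamma> ` R 0. \<forall>b\<in>?B. f b < 0\<close> obtain Q where "Q \<in> R 0" "\<forall>b\<in>?B. \<Gamma> Q b < 0" by blast
    then show thesis by (intro that[of Q]) (auto simp: \<Gamma>_def)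
  qed
  show thesis
    by (rule that[of Q]) (use Q in \<open>auto simp: R_def\<close>)
qed

section \<open>Dwell-time certificates\<close>

text \<open>
  For \<open>S (\<tau>, \<theta>) = exp (\<kappa> \<tau>) Q \<theta>\<close> with \<open>\<kappa> B = \<delta> / 2\<close> the time derivative costs at most
  \<open>exp (\<kappa> \<tau>) \<delta> / 2\<close> of the available decay \<open>exp (\<kappa> \<tau>) \<delta>\<close>. What is left is at least
  \<open>\<delta> / 2\<close>, as \<open>\<tau> \<ge> 0\<close>, so \<open>\<epsilon> = \<delta> / 2\<close> is a valid margin.
\<close>

lemma min_dwell_time_conditions_of_margins:
  fixes l u \<nu>l \<nu>u :: "real ^ 'N" and A Q :: "real ^ 'N \<Rightarrow> real ^ 'n ^ 'n"
  assumes Q: "Q differentiable_on cbox l u" "\<And>i. continuous_on (cbox l u) (box_partial l u Q i)"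
    and pos: "\<And>\<theta>. \<theta> \<in> cbox l u \<Longrightarrow> pos_def (Q \<theta>)"
    and lower: "\<And>\<theta> x. \<theta> \<in> cbox l u \<Longrightarrow> a * (x \<bullet> x) \<le> x \<bullet> (Q \<theta> *v x)"
    and upper: "\<And>\<theta> x. \<theta> \<in> cbox l u \<Longrightarrow> x \<bullet> (Q \<theta> *v x) \<le> B * (x \<bullet> x)"
    and decay: "\<And>\<theta> \<mu> x. \<theta> \<in> cbox l u \<Longrightarrow> \<mu> \<in> box_vertices \<nu>l \<nu>u \<Longrightarrow>
      lyapunov_form l u A Q (\<theta>, \<mu>, x) \<le> - \<delta> * (x \<bullet> x)"
    and params: "0 < \<delta>" "0 < B" "0 < T" "B \<le> exp (\<delta> / (2 * B) * T) * a"
  shows "min_dwell_time_conditions l u \<nu>l \<nu>u A T"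
proof -
  define \<kappa> where "\<kappa> = \<delta> / (2 * B)"
  have \<kappa>: "0 < \<kappa>" "\<kappa> * B = \<delta> / 2" using params by (auto simp: \<kappa>_def)
  define S where "S p = exp (\<kappa> * fst p) *\<^sub>R Q (snd p)" for p :: "real \<times> (real ^ 'N)"
  have S_pair: "S (\<tau>, \<theta>) = exp (\<kappa> * \<tau>) *\<^sub>R Q \<theta>" for \<tau> \<theta> by (simp add: S_def)
  have symQ: "transpose (Q \<theta>) = Q \<theta>" if "\<theta> \<in> cbox l u" for \<theta>
    using pos[OF that] by (simp add: pos_def_def)
  have symD: "transpose (box_deriv l u Q \<theta> \<mu>) = box_deriv l u Q \<theta> \<mu>" if "\<theta> \<in> cbox l u" for \<theta> \<mu>
    by (rule box_deriv_bounded_linear[OF Q(1) that bounded_linear_transpose, symmetric]) (simp add: symQ)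
  have time: "time_partial T S \<tau> \<theta> = (\<kappa> * exp (\<kappa> * \<tau>)) *\<^sub>R Q \<theta>" if "\<tau> \<in> {0..T}" for \<tau> \<theta>
  proof -
    have "((\<lambda>s. exp (\<kappa> * s)) has_real_derivative \<kappa> * exp (\<kappa> * \<tau>)) (at \<tau> within {0..T})"
      by (auto intro!: derivative_eq_intros)
    then have "((\<lambda>s. exp (\<kappa> * s) *\<^sub>R Q \<theta>) has_vector_derivative (\<kappa> * exp (\<kappa> * \<tau>)) *\<^sub>R Q \<theta>) (at \<tau> within {0..T})"
      using has_vector_derivative_scaleR[OF _ has_vector_derivative_const] by fastforce
    then show ?thesis
      unfolding time_partial_def S_pair
      by (intro vector_derivative_within_closed_interval) (use that params in auto)
  qed
  have partial: "box_partial l u (\<lambda>\<theta>'. S (\<tau>, \<theta>')) i \<theta> = exp (\<kappa> * \<tau>) *\<^sub>R box_partial l u Q i \<theta>"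
    and deriv: "box_deriv l u (\<lambda>\<theta>'. S (\<tau>, \<theta>')) \<theta> \<mu> = exp (\<kappa> * \<tau>) *\<^sub>R box_deriv l u Q \<theta> \<mu>"
    if "\<theta> \<in> cbox l u" for \<tau> i \<theta> \<mu>
    using box_deriv_add_scaled[OF Q(1) Q(1) that, where t = 0] by (simp_all add: S_pair)
  have contQ: "continuous_on (cbox l u) Q" by (rule differentiable_imp_continuous_on[OF Q(1)])
  note [continuous_intros] = continuous_on_compose2[OF contQ] continuous_on_compose2[OF Q(2)]
  have cS: "continuous_on ({0..T} \<times> cbox l u) S"
    unfolding S_def by (intro continuous_intros) auto
  have S_C1: "C1_on_time_box T l u S"
    unfolding C1_on_time_box_def
  proof (intro conjI allI)
    show "S differentiable_on {0..T} \<times> cbox l u"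
      unfolding differentiable_on_def
    proof
      fix p assume p: "p \<in> {0..T} \<times> cbox l u"
      obtain Q' where Q': "\<And>z. z \<in> cbox l u \<Longrightarrow> (Q has_derivative Q' z) (at z within cbox l u)"
        using Q(1) unfolding differentiable_on_def differentiable_def by metis
      have "((\<lambda>p. Q (snd p)) has_derivative (\<lambda>y. Q' (snd p) (snd y))) (at p within {0..T} \<times> cbox l u)"
        by (rule has_derivative_in_compose2[where t = "cbox l u" and g = Q and f = snd and f' = snd])
           (use p Q' in \<open>auto intro: bounded_linear_imp_has_derivative bounded_linear_snd\<close>)
      moreover have "((\<lambda>p. exp (\<kappa> * fst p)) has_derivative (\<lambda>y. exp (\<kappa> * fst p) * (\<kappa> * fst y))) (at p within {0..T} \<times> cbox l u)"
        by (auto intro!: derivative_eq_intros)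
      ultimately show "S differentiable at p within {0..T} \<times> cbox l u"
        unfolding S_def[abs_def] differentiable_def using has_derivative_scaleR by blast
    qed
    show "continuous_on ({0..T} \<times> cbox l u) (\<lambda>(\<tau>, \<theta>). time_partial T S \<tau> \<theta>)"
    proof (rule continuous_on_eq)
      show "continuous_on ({0..T} \<times> cbox l u) (\<lambda>p. (\<kappa> * exp (\<kappa> * fst p)) *\<^sub>R Q (snd p))"
        by (intro continuous_intros) auto
    qed (auto simp: time)
    show "continuous_on ({0..T} \<times> cbox l u) (\<lambda>(\<tau>, \<theta>). box_partial l u (\<lambda>\<theta>'. S (\<tau>, \<theta>')) i \<theta>)" for i
    proof (rule continuous_on_eq)
      show "continuous_on ({0..T} \<times> cbox l u) (\<lambda>p. exp (\<kappa> * fst p) *\<^sub>R box_partial l u Q i (snd p))"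
        by (intro continuous_intros) auto
    qed (auto simp: partial)
  qed
  have S_pos: "pos_def (S (\<tau>, \<theta>))" if "\<theta> \<in> cbox l u" for \<tau> \<theta>
    using pos[OF that] by (simp add: pos_def_def S_pair transpose_scalar scaleR_matrix_vector_assoc[symmetric])
  have S_bounded: "bounded (S ` ({0..T} \<times> cbox l u))"
    by (intro compact_imp_bounded compact_continuous_image cS compact_Times) auto
  \<comment> \<open>Covers both differential inequalities: \<open>c = 0\<close> at the end of the dwell time, and
    \<open>c = \<kappa> exp (\<kappa> \<tau>)\<close> during it.\<close>
  have ineq: "c *\<^sub>R Q \<theta> + box_deriv l u (\<lambda>\<theta>'. S (\<tau>, \<theta>')) \<theta> \<mu> + Sym (S (\<tau>, \<theta>) ** A \<theta>) + (\<delta> / 2) *\<^sub>R mat 1 \<preceq>\<^sub>L 0"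
    if \<theta>: "\<theta> \<in> cbox l u" and \<mu>: "\<mu> \<in> box_vertices \<nu>l \<nu>u" and \<tau>: "0 \<le> \<tau>"
      and c: "0 \<le> c" "c \<le> \<kappa> * exp (\<kappa> * \<tau>)" for c \<theta> \<mu> \<tau>
    unfolding loewner_le_0_iff
  proof (intro conjI allI)
    let ?e = "exp (\<kappa> * \<tau>)"
    show "transpose (c *\<^sub>R Q \<theta> + box_deriv l u (\<lambda>\<theta>'. S (\<tau>, \<theta>')) \<theta> \<mu> + Sym (S (\<tau>, \<theta>) ** A \<theta>) + (\<delta> / 2) *\<^sub>R mat 1)
        = c *\<^sub>R Q \<theta> + box_deriv l u (\<lambda>\<theta>'. S (\<tau>, \<theta>')) \<theta> \<mu> + Sym (S (\<tau>, \<theta>) ** A \<theta>) + (\<delta> / 2) *\<^sub>R mat 1"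
      by (simp add: transpose_add transpose_scalar symQ symD \<theta> deriv Sym_def add.commute)
    fix x :: "real ^ 'n"
    have symS: "transpose (S (\<tau>, \<theta>)) = S (\<tau>, \<theta>)" by (simp add: S_pair transpose_scalar symQ \<theta>)
    have "x \<bullet> ((c *\<^sub>R Q \<theta> + box_deriv l u (\<lambda>\<theta>'. S (\<tau>, \<theta>')) \<theta> \<mu> + Sym (S (\<tau>, \<theta>) ** A \<theta>) + (\<delta> / 2) *\<^sub>R mat 1) *v x)
        = c * (x \<bullet> (Q \<theta> *v x)) + \<delta> / 2 * (x \<bullet> x)
          + x \<bullet> ((?e *\<^sub>R box_deriv l u Q \<theta> \<mu> + transpose (A \<theta>) ** (?e *\<^sub>R Q \<theta>) + (?e *\<^sub>R Q \<theta>) ** A \<theta>) *v x)"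
      unfolding Sym_mult_symmetric[OF symS] deriv[OF \<theta>] unfolding S_pair
      by (simp add: matrix_vector_mult_add_rdistrib inner_add_right scaleR_matrix_vector_assoc[symmetric])
    also have "\<dots> = c * (x \<bullet> (Q \<theta> *v x)) + \<delta> / 2 * (x \<bullet> x) + ?e * lyapunov_form l u A Q (\<theta>, \<mu>, x)"
      unfolding lyapunov_form_def split quadratic_form_lyapunov
      by (simp add: scaleR_matrix_vector_assoc[symmetric] distrib_left)
    also have "\<dots> \<le> ?e * (\<delta> / 2) * (x \<bullet> x) + ?e * (\<delta> / 2) * (x \<bullet> x) + ?e * (- \<delta> * (x \<bullet> x))"
    proof (intro add_mono)
      have "c * (x \<bullet> (Q \<theta> *v x)) \<le> (\<kappa> * ?e) * (B * (x \<bullet> x))"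
      proof (rule mult_mono'[OF c(2) upper[OF \<theta>] c(1)])
        show "0 \<le> x \<bullet> (Q \<theta> *v x)"
          using pos[OF \<theta>] by (cases "x = 0") (auto simp: pos_def_def less_imp_le)
      qed
      also have "\<dots> = ?e * (\<kappa> * B) * (x \<bullet> x)" by simp
      finally show "c * (x \<bullet> (Q \<theta> *v x)) \<le> ?e * (\<delta> / 2) * (x \<bullet> x)" unfolding \<kappa>(2) .
      have "1 \<le> ?e" using \<kappa> \<tau> by simp
      then have "1 * (\<delta> / 2) \<le> ?e * (\<delta> / 2)" using params by (intro mult_right_mono) auto
      then show "\<delta> / 2 * (x \<bullet> x) \<le> ?e * (\<delta> / 2) * (x \<bullet> x)" by (intro mult_right_mono) auto
      show "?e * lyapunov_form l u A Q (\<theta>, \<mu>, x) \<le> ?e * (- \<delta> * (x \<bullet> x))"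
        by (rule mult_left_mono[OF decay[OF \<theta> \<mu>]]) simp
    qed
    also have "\<dots> = 0" by (simp add: field_simps)
    finally show "x \<bullet> ((c *\<^sub>R Q \<theta> + box_deriv l u (\<lambda>\<theta>'. S (\<tau>, \<theta>')) \<theta> \<mu> + Sym (S (\<tau>, \<theta>) ** A \<theta>) + (\<delta> / 2) *\<^sub>R mat 1) *v x) \<le> 0" .
  qed
  have jump: "S (0, \<theta>) - S (T, \<eta>) \<preceq>\<^sub>L 0" if "\<theta> \<in> cbox l u" "\<eta> \<in> cbox l u" for \<theta> \<eta>
    unfolding loewner_le_0_iff
  proof (intro conjI allI)
    show "transpose (S (0, \<theta>) - S (T, \<eta>)) = S (0, \<theta>) - S (T, \<eta>)"
      using that by (simp add: linear_simps(2)[OF bounded_linear_transpose] S_pair transpose_scalar symQ)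
    fix x :: "real ^ 'n"
    have "x \<bullet> (Q \<theta> *v x) \<le> B * (x \<bullet> x)" by (rule upper[OF that(1)])
    also have "\<dots> \<le> (exp (\<kappa> * T) * a) * (x \<bullet> x)"
      using params(4) by (intro mult_right_mono) (auto simp: \<kappa>_def)
    also have "\<dots> = exp (\<kappa> * T) * (a * (x \<bullet> x))" by simp
    also have "\<dots> \<le> exp (\<kappa> * T) * (x \<bullet> (Q \<eta> *v x))"
      by (rule mult_left_mono[OF lower[OF that(2)]]) simp
    finally show "x \<bullet> ((S (0, \<theta>) - S (T, \<eta>)) *v x) \<le> 0"
      by (simp add: S_pair matrix_vector_mult_diff_rdistrib inner_diff_right scaleR_matrix_vector_assoc[symmetric])
  qed
  show ?thesis
    unfolding min_dwell_time_conditions_def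
  proof (intro exI[of _ S] exI[of _ "\<delta> / 2"] conjI ballI)
    fix \<theta> \<eta> \<mu> \<tau>
    assume \<theta>: "\<theta> \<in> cbox l u" and \<eta>: "\<eta> \<in> cbox l u" and \<mu>: "\<mu> \<in> box_vertices \<nu>l \<nu>u" and \<tau>: "\<tau> \<in> {0..T}"
    show "box_deriv l u (\<lambda>\<theta>'. S (T, \<theta>')) \<theta> \<mu> + Sym (S (T, \<theta>) ** A \<theta>) + (\<delta> / 2) *\<^sub>R mat 1 \<preceq>\<^sub>L 0"
      using ineq[OF \<theta> \<mu>, of T 0] \<kappa> params by simp
    show "time_partial T S \<tau> \<theta> + box_deriv l u (\<lambda>\<theta>'. S (\<tau>, \<theta>')) \<theta> \<mu> + Sym (S (\<tau>, \<theta>) ** A \<theta>) + (\<delta> / 2) *\<^sub>R mat 1 \<preceq>\<^sub>L 0"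
      unfolding time[OF \<tau>] using ineq[OF \<theta> \<mu>, of \<tau>] \<tau> \<kappa> by simp
    show "S (0, \<theta>) - S (T, \<eta>) \<preceq>\<^sub>L 0" by (rule jump[OF \<theta> \<eta>])
  qed (use S_bounded S_C1 S_pos params in auto)
qed

text \<open>The certificate evaluated at the end of the dwell time, \<open>S (T, \<cdot>)\<close>, is the required \<open>P\<close>.\<close>

lemma strict_lyapunov_of_min_dwell_time_conditions:
  fixes l u \<nu>l \<nu>u :: "real ^ 'N" and A :: "real ^ 'N \<Rightarrow> real ^ 'n ^ 'n"
  assumes T: "0 \<le> T" and "min_dwell_time_conditions l u \<nu>l \<nu>u A T"
  shows "\<exists>P :: real ^ 'N \<Rightarrow> real ^ 'n ^ 'n.
       P differentiable_on cbox l u \<and> (\<forall>\<theta>\<in>cbox l u. pos_def (P \<theta>)) \<and>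
       (\<forall>\<theta>\<in>cbox l u. \<forall>\<mu>\<in>box_vertices \<nu>l \<nu>u.
          box_deriv l u P \<theta> \<mu> + transpose (A \<theta>) ** P \<theta> + P \<theta> ** A \<theta> \<prec>\<^sub>L 0)"
proof -
  obtain S \<epsilon> where S: "C1_on_time_box T l u S" and pos: "\<forall>\<tau>\<in>{0..T}. \<forall>\<theta>\<in>cbox l u. pos_def (S (\<tau>, \<theta>))"
    and \<epsilon>: "\<epsilon> > 0"
    and le: "\<And>\<theta> \<mu>. \<theta> \<in> cbox l u \<Longrightarrow> \<mu> \<in> box_vertices \<nu>l \<nu>u \<Longrightarrow>
       box_deriv l u (\<lambda>\<theta>'. S (T, \<theta>')) \<theta> \<mu> + Sym (S (T, \<theta>) ** A \<theta>) + \<epsilon> *\<^sub>R mat 1 \<preceq>\<^sub>L 0"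
  proof -
    from assms(2) obtain S \<epsilon> where *: "C1_on_time_box T l u S" "\<forall>\<tau>\<in>{0..T}. \<forall>\<theta>\<in>cbox l u. pos_def (S (\<tau>, \<theta>))" "\<epsilon> > 0"
      "\<forall>\<theta>\<in>cbox l u. \<forall>\<eta>\<in>cbox l u. \<forall>\<mu>\<in>box_vertices \<nu>l \<nu>u. \<forall>\<tau>\<in>{0..T}.
       box_deriv l u (\<lambda>\<theta>'. S (T, \<theta>')) \<theta> \<mu> + Sym (S (T, \<theta>) ** A \<theta>) + \<epsilon> *\<^sub>R mat 1 \<preceq>\<^sub>L 0"
      unfolding min_dwell_time_conditions_def by blast
    show thesis by (rule that[OF *(1-3)]) (use *(4) T in force)
  qed
  define P where "P = (\<lambda>\<theta>. S (T, \<theta>))"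
  have "P differentiable_on cbox l u"
    unfolding differentiable_on_def
  proof
    fix \<theta> assume \<theta>: "\<theta> \<in> cbox l u"
    obtain S' where S': "\<And>p. p \<in> {0..T} \<times> cbox l u \<Longrightarrow> (S has_derivative S' p) (at p within {0..T} \<times> cbox l u)"
      using S unfolding C1_on_time_box_def differentiable_on_def differentiable_def by metis
    have "(P has_derivative (\<lambda>v. S' (T, \<theta>) (0, v))) (at \<theta> within cbox l u)"
      unfolding P_def
      by (rule has_derivative_in_compose2[where t = "{0..T} \<times> cbox l u" and g = S and f = "Pair T" and f' = "Pair 0"])
         (use S' \<theta> T in \<open>auto intro!: has_derivative_Pair has_derivative_const has_derivative_ident\<close>)
    then show "P differentiable at \<theta> within cbox l u" by (auto simp: differentiable_def)
  qed
  moreover have P_pos: "pos_def (P \<theta>)" if "\<theta> \<in> cbox l u" for \<theta> using pos T that by (simp add: P_def)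
  moreover have "box_deriv l u P \<theta> \<mu> + transpose (A \<theta>) ** P \<theta> + P \<theta> ** A \<theta> \<prec>\<^sub>L 0"
    if \<theta>: "\<theta> \<in> cbox l u" and \<mu>: "\<mu> \<in> box_vertices \<nu>l \<nu>u" for \<theta> \<mu>
  proof -
    let ?X = "box_deriv l u P \<theta> \<mu> + transpose (A \<theta>) ** P \<theta> + P \<theta> ** A \<theta>"
    have "transpose (P \<theta>) = P \<theta>" using P_pos[OF \<theta>] by (simp add: pos_def_def)
    then have X: "?X + \<epsilon> *\<^sub>R mat 1 \<preceq>\<^sub>L 0"
      using le[OF \<theta> \<mu>] Sym_mult_symmetric[of "P \<theta>" "A \<theta>"] by (simp add: P_def add.assoc)
    then have "transpose ?X = ?X"
      unfolding loewner_le_0_iff by (simp add: transpose_add[of ?X] transpose_scalar)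
    moreover have "x \<bullet> (?X *v x) < 0" if "x \<noteq> 0" for x
    proof -
      have "x \<bullet> ((?X + \<epsilon> *\<^sub>R mat 1) *v x) \<le> 0" using X unfolding loewner_le_0_iff by blast
      then have "x \<bullet> (?X *v x) + \<epsilon> * (x \<bullet> x) \<le> 0"
        by (simp add: matrix_vector_mult_add_rdistrib[of ?X] inner_add_right[of x "?X *v x"] scaleR_matrix_vector_assoc[symmetric])
      moreover have "0 < \<epsilon> * (x \<bullet> x)" using \<epsilon> that by simp
      ultimately show ?thesis by linarith
    qed
    ultimately show ?thesis unfolding loewner_less_0_iff by blast
  qed
  ultimately show ?thesis by blast
qed

theorem proposition5:
  fixes \<rho>l \<rho>u \<nu>l \<nu>u :: "real ^ 'N"
    and A :: "real ^ 'N \<Rightarrow> real ^ 'n ^ 'n"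
  assumes "\<And>i. \<rho>l $ i \<le> \<rho>u $ i"
    and "\<And>i. \<nu>l $ i \<le> \<nu>u $ i"
    and "bounded (A ` cbox \<rho>l \<rho>u)"
    and "continuous_on (cbox \<rho>l \<rho>u) A"
  shows "(\<forall>\<^sub>F T in at_top. min_dwell_time_conditions \<rho>l \<rho>u \<nu>l \<nu>u A T) \<longleftrightarrow>
    (\<exists>P :: real ^ 'N \<Rightarrow> real ^ 'n ^ 'n.
       P differentiable_on cbox \<rho>l \<rho>u \<and>
       (\<forall>\<theta>\<in>cbox \<rho>l \<rho>u. pos_def (P \<theta>)) \<and>
       (\<forall>\<theta>\<in>cbox \<rho>l \<rho>u. \<forall>\<mu>\<in>box_vertices \<nu>l \<nu>u.
          box_deriv \<rho>l \<rho>u P \<theta> \<mu> + transpose (A \<theta>) ** P \<theta> + P \<theta> ** A \<theta> \<prec>\<^sub>L 0))"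
proof
  assume "\<forall>\<^sub>F T in at_top. min_dwell_time_conditions \<rho>l \<rho>u \<nu>l \<nu>u A T"
  then have "\<forall>\<^sub>F T in at_top. min_dwell_time_conditions \<rho>l \<rho>u \<nu>l \<nu>u A T \<and> 0 \<le> T"
    using eventually_ge_at_top by (rule eventually_conj)
  then obtain T where "0 \<le> T" "min_dwell_time_conditions \<rho>l \<rho>u \<nu>l \<nu>u A T"
    using eventually_happens' trivial_limit_at_top_linorder by blast
  then show "\<exists>P :: real ^ 'N \<Rightarrow> real ^ 'n ^ 'n.
       P differentiable_on cbox \<rho>l \<rho>u \<and>
       (\<forall>\<theta>\<in>cbox \<rho>l \<rho>u. pos_def (P \<theta>)) \<and>
       (\<forall>\<theta>\<in>cbox \<rho>l \<rho>u. \<forall>\<mu>\<in>box_vertices \<nu>l \<nu>u.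
          box_deriv \<rho>l \<rho>u P \<theta> \<mu> + transpose (A \<theta>) ** P \<theta> + P \<theta> ** A \<theta> \<prec>\<^sub>L 0)"
    by (rule strict_lyapunov_of_min_dwell_time_conditions)
next
  let ?K = "cbox \<rho>l \<rho>u" and ?S = "sphere 0 1 :: (real ^ 'n) set" and ?V = "box_vertices \<nu>l \<nu>u"
  assume "\<exists>P :: real ^ 'N \<Rightarrow> real ^ 'n ^ 'n.
       P differentiable_on ?K \<and> (\<forall>\<theta>\<in>?K. pos_def (P \<theta>)) \<and>
       (\<forall>\<theta>\<in>?K. \<forall>\<mu>\<in>?V. box_deriv \<rho>l \<rho>u P \<theta> \<mu> + transpose (A \<theta>) ** P \<theta> + P \<theta> ** A \<theta> \<prec>\<^sub>L 0)"
  then obtain P :: "real ^ 'N \<Rightarrow> real ^ 'n ^ 'n" where P: "P differentiable_on ?K" "\<And>\<theta>. \<theta> \<in> ?K \<Longrightarrow> pos_def (P \<theta>)"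
    "\<And>\<theta> \<mu>. \<theta> \<in> ?K \<Longrightarrow> \<mu> \<in> ?V \<Longrightarrow> box_deriv \<rho>l \<rho>u P \<theta> \<mu> + transpose (A \<theta>) ** P \<theta> + P \<theta> ** A \<theta> \<prec>\<^sub>L 0"
    by blast
  obtain Q where Q: "Q differentiable_on ?K" "\<And>i. continuous_on ?K (box_partial \<rho>l \<rho>u Q i)"
    and Q_pos: "\<And>\<theta>. \<theta> \<in> ?K \<Longrightarrow> pos_def (Q \<theta>)"
    and Q_neg: "\<And>b. b \<in> ?K \<times> ?V \<times> ?S \<Longrightarrow> lyapunov_form \<rho>l \<rho>u A Q b < 0"
    using exists_C1_strict_lyapunov[OF assms(1) assms(4) P] by blast
  have K_ne: "?K \<noteq> {}" using assms(1) by (simp add: interval_ne_empty_cart)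
  have V_ne: "?V \<noteq> {}" by (auto simp: box_vertices_def intro!: exI[of _ \<nu>l])
  have S_ne: "?S \<noteq> {}" by simp
  have "continuous_on (?K \<times> ?V \<times> ?S) (lyapunov_form \<rho>l \<rho>u A Q)"
    by (rule continuous_on_lyapunov_form[OF Q assms(4)])
  moreover have "compact (?K \<times> ?V \<times> ?S)"
    by (intro compact_Times compact_cbox compact_box_vertices compact_sphere)
  ultimately obtain b where b: "b \<in> ?K \<times> ?V \<times> ?S"
    "\<And>y. y \<in> ?K \<times> ?V \<times> ?S \<Longrightarrow> lyapunov_form \<rho>l \<rho>u A Q y \<le> lyapunov_form \<rho>l \<rho>u A Q b"
    using continuous_attains_sup[of "?K \<times> ?V \<times> ?S"] K_ne V_ne S_ne by (metis Times_empty)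
  define \<delta> where "\<delta> = - lyapunov_form \<rho>l \<rho>u A Q b"
  have \<delta>: "0 < \<delta>" using Q_neg[OF b(1)] by (simp add: \<delta>_def)
  have decay: "lyapunov_form \<rho>l \<rho>u A Q (\<theta>, \<mu>, x) \<le> - \<delta> * (x \<bullet> x)" if "\<theta> \<in> ?K" "\<mu> \<in> ?V" for \<theta> \<mu> x
    unfolding lyapunov_form_def split
    by (rule quadratic_form_le_of_sphere)
       (use b(2)[of "(\<theta>, \<mu>, _)"] that in \<open>auto simp: \<delta>_def lyapunov_form_def\<close>)
  have contQ: "continuous_on ?K Q" by (rule differentiable_imp_continuous_on[OF Q(1)])
  have form_cont: "continuous_on (?K \<times> ?S) (\<lambda>(\<theta>, x). x \<bullet> (Q \<theta> *v x))"
    unfolding split_beta by (intro continuous_intros continuous_on_compose2[OF contQ]) auto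
  have KS: "compact (?K \<times> ?S)" "?K \<times> ?S \<noteq> {}"
    using K_ne S_ne by (auto intro: compact_Times)
  obtain p where p: "p \<in> ?K \<times> ?S" "\<forall>y\<in>?K \<times> ?S. (\<lambda>(\<theta>, x). x \<bullet> (Q \<theta> *v x)) p \<le> (\<lambda>(\<theta>, x). x \<bullet> (Q \<theta> *v x)) y"
    using continuous_attains_inf[OF KS form_cont] by blast
  obtain q where q: "q \<in> ?K \<times> ?S" "\<forall>y\<in>?K \<times> ?S. (\<lambda>(\<theta>, x). x \<bullet> (Q \<theta> *v x)) y \<le> (\<lambda>(\<theta>, x). x \<bullet> (Q \<theta> *v x)) q"
    using continuous_attains_sup[OF KS form_cont] by blast
  define a where "a = (\<lambda>(\<theta>, x). x \<bullet> (Q \<theta> *v x)) p"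
  define B where "B = (\<lambda>(\<theta>, x). x \<bullet> (Q \<theta> *v x)) q"
  have a: "0 < a"
  proof -
    obtain \<theta> x where \<theta>x: "p = (\<theta>, x)" "\<theta> \<in> ?K" "norm x = 1" using p(1) by auto
    moreover from this have "x \<noteq> 0" by auto
    ultimately show ?thesis using Q_pos[of \<theta>] by (simp add: a_def pos_def_def)
  qed
  have "a \<le> B" unfolding a_def B_def by (rule bspec[OF p(2) q(1)])
  then have B: "0 < B" using a by simp
  have lower: "a * (x \<bullet> x) \<le> x \<bullet> (Q \<theta> *v x)" if "\<theta> \<in> ?K" for \<theta> x
    by (rule quadratic_form_ge_of_sphere) (use p(2) that in \<open>force simp: a_def\<close>)
  have upper: "x \<bullet> (Q \<theta> *v x) \<le> B * (x \<bullet> x)" if "\<theta> \<in> ?K" for \<theta> x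
    by (rule quadratic_form_le_of_sphere) (use q(2) that in \<open>force simp: B_def\<close>)
  \<comment> \<open>From \<open>T0\<close> on, the growth factor exceeds the condition number bound \<open>B / a\<close> of \<open>Q\<close>.\<close>
  define T0 where "T0 = ln (B / a) / (\<delta> / (2 * B))"
  have "\<forall>\<^sub>F T in at_top. T0 \<le> T \<and> 0 < T"
    by (intro eventually_conj eventually_ge_at_top eventually_gt_at_top)
  then show "\<forall>\<^sub>F T in at_top. min_dwell_time_conditions \<rho>l \<rho>u \<nu>l \<nu>u A T"
  proof eventually_elim
    case (elim T)
    have "ln (B / a) \<le> \<delta> / (2 * B) * T"
      using elim \<delta> B by (simp add: T0_def field_simps)
    then have "B / a \<le> exp (\<delta> / (2 * B) * T)" using a B by (metis divide_pos_pos exp_le_cancel_iff exp_ln)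
    then have "B \<le> exp (\<delta> / (2 * B) * T) * a" using a by (simp add: pos_divide_le_eq)
    then show ?case
      using min_dwell_time_conditions_of_margins[OF Q Q_pos lower upper decay \<delta> B] elim by blast
  qed
qed

end
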